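(* Let $A$ be an associative unital $\mathbb K$-algebra. For every character $\Phi\in G_{NC}(A)$ there exists a unique infinitesimal character $\kappa\in g_{NC}(A)$ such that $$\Phi=e+\kappa\prec\Phi=\exp^\prec(\kappa),$$ and conversely, for every $\kappa\in g_{NC}(A)$, $\Phi:=\exp^\prec(\kappa)$ is a character; this gives a bijection $G_{NC}(A)\leftrightarrow g_{NC}(A)$. Moreover, if $\Phi$ and $\kappa$ are related in this way, then $$Sp^\ast(\Phi)=e+Sp^\ast(\kappa)\prec Sp^\ast(\Phi)=\exp^\prec(Sp^\ast(\kappa)).$$
   Context: $\mathbb K$ is a field of characteristic zero, $m_{\mathbb K}$ its multiplication. Double tensor algebra: $T(A)=\bigoplus_{n\ge1}A^{\otimes n}$ (words $a_1\cdots a_n$); for $S=\{s_1<\dots<s_k\}\subseteq[n]=\{1,\dots,n\}$, $a_S=a_{s_1}\cdots a_{s_k}$, $a_\emptyset=\mathbf 1$. $\overline T(T(A))=\bigoplus_{k\ge0}T(A)^{\otimes k}$ (bar notation, concatenation, unit $\mathbf 1$). Coproduct $\Delta(a_1\cdots a_n)=\sum_{S\subseteq[n]}a_S\otimes a_{J_1}|\cdots|a_{J_k}$ with $J_1,\dots,J_k$ the maximal sets of consecutive integers in $[n]\setminus S$ (empty bar word $=\mathbf 1$), extended multiplicatively; $\Delta^+_\prec$ is the sum over $S\ni1$, $\Delta^+_\succ$ over $S\not\ni1$; $\Delta_\prec(w)=\Delta^+_\prec(w)-w\otimes\mathbf 1$, $\Delta_\succ(w)=\Delta^+_\succ(w)-\mathbf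 1\otimes w$, $\Delta^+_\prec(w_1|\cdots|w_m)=\Delta^+_\prec(w_1)\Delta(w_2)\cdots\Delta(w_m)$ and likewise for $\succ$. Decorated non-crossing partitions: a partition of a finite $S\subset\mathbb N$ is non-crossing if there are no $p_1<q_1<p_2<q_2$ in $S$ with $p_1,p_2$ in one block and $q_1,q_2$ in another; $NC_n$ = non-crossing partitions of $[n]$, $\mathcal{NC}_n$ its span, $\mathcal{NC}(A)=\bigoplus_{n\ge1}\mathcal{NC}_n\otimes A^{\otimes n}$, graded by $n$. For blocks $B,C$ of $L$, $B<_LC$ iff $\inf C<m<\sup C$ for all $m\in B$; $L=Q\sqcup U$ (parts possibly empty) is admissible if no $B\in Q$, $C\in U$ satisfy $B<_LC$; then $J_1,\dots,J_k$ are the maximal sets of consecutive integers in $[n]\setminus\bigcup Q$, $J_i^{L,Q}$ the partition of $J_i$ by the blocks of $U$ in it, $a_Q=a_{\bigcup Q}$, $a_{J_i^{L,Q}}=a_{J_i}$; $st$ is the increasing bijection of a finite set onto $[m]$, applied to partitions by transport. $\overline T(\mathcal{NC}(A))$ is the unital tensor algebra with coproduct $\Delta(L\otimes a_1\cdots a_n)=\sum_{L=Q\sqcup U\text{ adm}}(st(Q)\otimes a_Q)\otimes(st(J_1^{L,Q})\otimes a_{J_1^{L,Q}}|\cdots|st(J_k^{L,Q})\otimes a_{J_k^{L,Q}})$, extended multiplicatively; $\Delta^+_\prec$ (resp. $\Delta^+_\succ$) restricts the sum to decompositions in which the block containing $1$ lies in $Q$ (resp. $U$), and $\Delta_\prec,\Delta_\succ$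 are obtained as for $\overline T(T(A))$. Splitting map: $Sp(a_1\cdots a_n)=\sum_{L\in NC_n}L\otimes(a_1\cdots a_n)$, extended by $Sp(A_1|\cdots|A_k)=Sp(A_1)|\cdots|Sp(A_k)$, $Sp(\mathbf 1)=\mathbf 1$; $Sp^\ast(f)=f\circ Sp$. On $\mathrm{Lin}(\overline T(H),\mathbb K)$ ($H=T(A)$ or $\mathcal{NC}(A)$): $f\prec g=m_{\mathbb K}(f\otimes g)\Delta_\prec$, $f\succ g=m_{\mathbb K}(f\otimes g)\Delta_\succ$ on $T(H)$; the unit $e$ vanishes on $T(H)$ and is $1$ on $\mathbf 1$, with $f\prec e=f=e\succ f$, $e\prec f=0=f\succ e$ for $f$ vanishing on $\mathbf 1$. $\kappa^{\prec0}=e$, $\kappa^{\prec n}=\kappa\prec\kappa^{\prec(n-1)}$, $\exp^\prec(\kappa)=\sum_{n\ge0}\kappa^{\prec n}$ (a finite sum in each degree). A character is a linear form $\Phi$ on $\overline T(H)$ with $\Phi(\mathbf 1)=1$ and $\Phi(a|b)=\Phi(a)\Phi(b)$ for $a,b\in T(H)$; an infinitesimal character is $\kappa$ with $\kappa(\mathbf 1)=0$ and $\kappa(a|b)=0$ for $a,b\in T(H)$. $G_{NC}(A)$, $g_{NC}(A)$ denote characters and infinitesimal characters on $\overline T(\mathcal{NC}(A))$. *)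

theory Defs
  imports Complex_Main "HOL-Library.Poly_Mapping" "HOL-Library.Disjoint_Sets"
begin

definition is_algebra :: "('k::field \<Rightarrow> 'a::{ring,monoid_mult} \<Rightarrow> 'a) \<Rightarrow> bool" where
  "is_algebra scale \<longleftrightarrow> vector_space scale \<and>
     (\<forall>c x y. scale c (x * y) = scale c x * y \<and> scale c (x * y) = x * scale c y)"


section \<open>Free vector spaces\<close>

definition fscale :: "'k::field \<Rightarrow> ('x \<Rightarrow>\<^sub>0 'k) \<Rightarrow> ('x \<Rightarrow>\<^sub>0 'k)" where
  "fscale c v = Poly_Mapping.map ((*) c) v"

abbreviation basis_vec :: "'x \<Rightarrow> ('x \<Rightarrow>\<^sub>0 'k::field)" where
  "basis_vec x \<equiv> Poly_Mapping.single x 1"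

definition linear_ext :: "('x \<Rightarrow> ('y \<Rightarrow>\<^sub>0 'k)) \<Rightarrow> ('x \<Rightarrow>\<^sub>0 'k::field) \<Rightarrow> ('y \<Rightarrow>\<^sub>0 'k)" where
  "linear_ext h v = (\<Sum>x\<in>Poly_Mapping.keys v. fscale (Poly_Mapping.lookup v x) (h x))"

definition bilinear_ext ::
  "('x \<Rightarrow> 'x \<Rightarrow> 'x) \<Rightarrow> ('x \<Rightarrow>\<^sub>0 'k::field) \<Rightarrow> ('x \<Rightarrow>\<^sub>0 'k) \<Rightarrow> ('x \<Rightarrow>\<^sub>0 'k)" where
  "bilinear_ext m u v = (\<Sum>x\<in>Poly_Mapping.keys u. \<Sum>y\<in>Poly_Mapping.keys v.
     Poly_Mapping.single (m x y) (Poly_Mapping.lookup u x * Poly_Mapping.lookup v y))"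


section \<open>Unital tensor algebras\<close>

text \<open>
  The vector space \<open>H\<close> is presented by a type \<open>'x\<close> of decorated words \<open>L \<otimes> a\<^sub>1\<dots>a\<^sub>n\<close> (just
  \<open>a\<^sub>1\<dots>a\<^sub>n\<close> if \<open>H = T(A)\<close>), and its unital tensor algebra is the quotient of the free
  vector space on bar words \<open>w\<^sub>1|\<dots>|w\<^sub>k\<close> (lists over \<open>'x\<close>; the empty list is the unit) by the
  span of the relations making a bar word linear in each letter \<open>a\<^sub>i \<in> A\<close>. The set \<open>M\<close> lists the
  decorations: \<open>(n, mk) \<in> M\<close> means that \<open>mk\<close> turns words of length \<open>n\<close> into elements of \<open>'x\<close>.

  Maps out of the quotient are handled in the usual way, as maps on representatives which
  respect the congruence.
\<close>

type_synonym ('x, 'k) tensor = "'x list \<Rightarrow>\<^sub>0 'k"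
type_synonym ('x, 'k) tensor2 = "('x list \<times> 'x list) \<Rightarrow>\<^sub>0 'k"

definition tensor_relations ::
  "('k \<Rightarrow> 'a::ab_group_add \<Rightarrow> 'a) \<Rightarrow> (nat \<times> ('a list \<Rightarrow> 'x)) set \<Rightarrow> ('x, 'k::field) tensor set" where
  "tensor_relations scale M =
     {basis_vec (u @ mk (p @ (x + y) # q) # v)
        - basis_vec (u @ mk (p @ x # q) # v) - basis_vec (u @ mk (p @ y # q) # v)
      | u v p q x y mk. (length p + 1 + length q, mk) \<in> M}
   \<union> {basis_vec (u @ mk (p @ scale c x # q) # v) - fscale c (basis_vec (u @ mk (p @ x # q) # v))
      | u v p q c x mk. (length p + 1 + length q, mk) \<in> M}"

definition tensor_cong ::
  "('k \<Rightarrow> 'a::ab_group_add \<Rightarrow> 'a) \<Rightarrow> (nat \<times> ('a list \<Rightarrow> 'x)) set \<Rightarrow> (('x, 'k::field) tensor \<times> ('x, 'k) tensor) set" where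
  "tensor_cong scale M = {(u, v). u - v \<in> module.span fscale (tensor_relations scale M)}"

definition linear_forms ::
  "('k \<Rightarrow> 'a::ab_group_add \<Rightarrow> 'a) \<Rightarrow> (nat \<times> ('a list \<Rightarrow> 'x)) set \<Rightarrow> (('x, 'k::field) tensor \<Rightarrow> 'k) set" where
  "linear_forms scale M = {f. Vector_Spaces.linear fscale (*) f \<and> f respects tensor_cong scale M}"

abbreviation tensor_one :: "('x, 'k::field) tensor" where
  "tensor_one \<equiv> basis_vec []"

definition bar :: "('x, 'k::field) tensor \<Rightarrow> ('x, 'k) tensor \<Rightarrow> ('x, 'k) tensor" where
  "bar = bilinear_ext (@)"

definition augmentation_ideal :: "('x, 'k::field) tensor set" where
  "augmentation_ideal = {v. Poly_Mapping.lookup v [] = 0}"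

definition characters ::
  "('k \<Rightarrow> 'a::ab_group_add \<Rightarrow> 'a) \<Rightarrow> (nat \<times> ('a list \<Rightarrow> 'x)) set \<Rightarrow> (('x, 'k::field) tensor \<Rightarrow> 'k) set" where
  "characters scale M = {\<Phi> \<in> linear_forms scale M. \<Phi> tensor_one = 1 \<and>
     (\<forall>a\<in>augmentation_ideal. \<forall>b\<in>augmentation_ideal. \<Phi> (bar a b) = \<Phi> a * \<Phi> b)}"

definition inf_characters ::
  "('k \<Rightarrow> 'a::ab_group_add \<Rightarrow> 'a) \<Rightarrow> (nat \<times> ('a list \<Rightarrow> 'x)) set \<Rightarrow> (('x, 'k::field) tensor \<Rightarrow> 'k) set" where
  "inf_characters scale M = {\<kappa> \<in> linear_forms scale M. \<kappa> tensor_one = 0 \<and>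
     (\<forall>a\<in>augmentation_ideal. \<forall>b\<in>augmentation_ideal. \<kappa> (bar a b) = 0)}"


section \<open>Left half-shuffle and its exponential\<close>

definition bar2 :: "('x, 'k::field) tensor2 \<Rightarrow> ('x, 'k) tensor2 \<Rightarrow> ('x, 'k) tensor2" where
  "bar2 = bilinear_ext (\<lambda>(a, b) (c, d). (a @ c, b @ d))"

text \<open>
  Below \<open>D\<close> stands for the coproduct \<open>\<Delta>\<close> on \<open>H\<close> and \<open>Dl\<close> for \<open>\<Delta>\<^sup>+\<^sub>\<prec>\<close> on \<open>H\<close>.
\<close>

primrec coprod :: "('x \<Rightarrow> ('x, 'k::field) tensor2) \<Rightarrow> 'x list \<Rightarrow> ('x, 'k) tensor2" where
  "coprod D [] = basis_vec ([], [])"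
| "coprod D (w # ws) = bar2 (D w) (coprod D ws)"

primrec coprod_left ::
  "('x \<Rightarrow> ('x, 'k::field) tensor2) \<Rightarrow> ('x \<Rightarrow> ('x, 'k) tensor2) \<Rightarrow> 'x list \<Rightarrow> ('x, 'k) tensor2" where
  "coprod_left D Dl [] = 0"
| "coprod_left D Dl (w # ws) = bar2 (Dl w) (coprod D ws) - basis_vec (w # ws, [])"

definition tensor_forms ::
  "(('x, 'k::field) tensor \<Rightarrow> 'k) \<Rightarrow> (('x, 'k) tensor \<Rightarrow> 'k) \<Rightarrow> ('x, 'k) tensor2 \<Rightarrow> 'k" where
  "tensor_forms f g t = (\<Sum>(x, y)\<in>Poly_Mapping.keys t.
     Poly_Mapping.lookup t (x, y) * (f (basis_vec x) * g (basis_vec y)))"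

definition unit_form :: "('x, 'k::field) tensor \<Rightarrow> 'k" where
  "unit_form v = Poly_Mapping.lookup v []"

text \<open>
  \<open>\<Delta>\<^sub>\<prec>\<close> takes values in \<open>T(H) \<otimes> T(H)\<close>, so the first summand of \<open>prec\<close> only sees the restrictions of
  \<open>f\<close> and \<open>g\<close> to \<open>T(H)\<close>; the second one is the bilinear extension of \<open>f \<prec> e = f\<close>, \<open>e \<prec> f = 0\<close> for \<open>f\<close>
  vanishing on the unit. (The value \<open>e \<prec> e\<close>, usually left undefined, becomes \<open>0\<close>.)
\<close>

definition prec ::
  "('x list \<Rightarrow> ('x, 'k::field) tensor2) \<Rightarrow> (('x, 'k) tensor \<Rightarrow> 'k) \<Rightarrow> (('x, 'k) tensor \<Rightarrow> 'k)
     \<Rightarrow> ('x, 'k) tensor \<Rightarrow> 'k" where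
  "prec \<Delta>l f g v = tensor_forms f g (linear_ext \<Delta>l v)
     + g tensor_one * (f v - f tensor_one * unit_form v)"

primrec prec_power ::
  "('x list \<Rightarrow> ('x, 'k::field) tensor2) \<Rightarrow> (('x, 'k) tensor \<Rightarrow> 'k) \<Rightarrow> nat
     \<Rightarrow> ('x, 'k) tensor \<Rightarrow> 'k" where
  "prec_power \<Delta>l \<kappa> 0 = unit_form"
| "prec_power \<Delta>l \<kappa> (Suc n) = prec \<Delta>l \<kappa> (prec_power \<Delta>l \<kappa> n)"

definition prec_exp ::
  "('x list \<Rightarrow> ('x, 'k::field) tensor2) \<Rightarrow> (('x, 'k) tensor \<Rightarrow> 'k) \<Rightarrow> ('x, 'k) tensor \<Rightarrow> 'k" where
  "prec_exp \<Delta>l \<kappa> v = Sum_any (\<lambda>n. prec_power \<Delta>l \<kappa> n v)"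


section \<open>Words and intervals\<close>

definition subword :: "'a list \<Rightarrow> nat set \<Rightarrow> 'a list" where
  "subword w S = map (\<lambda>i. w ! (i - 1)) (sorted_list_of_set S)"

definition is_interval :: "nat set \<Rightarrow> bool" where
  "is_interval J \<longleftrightarrow> J \<noteq> {} \<and> (\<exists>a b. J = {a..b})"

definition components :: "nat set \<Rightarrow> nat set set" where
  "components X = {J. is_interval J \<and> J \<subseteq> X \<and>
     (\<forall>J'. is_interval J' \<and> J' \<subseteq> X \<and> J \<subseteq> J' \<longrightarrow> J' = J)}"

definition component_list :: "nat set \<Rightarrow> nat set list" where
  "component_list X = sorted_key_list_of_set Min (components X)"


section \<open>The double tensor algebra\<close>

typedef 'a word = "{w :: 'a list. w \<noteq> []}"
  morphisms letters Word
  by (rule exI[of _ "[undefined]"]) simp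

definition word_decorations :: "(nat \<times> ('a list \<Rightarrow> 'a word)) set" where
  "word_decorations = {(n, Word) | n. n \<ge> 1}"

definition word_term :: "'a word \<Rightarrow> nat set \<Rightarrow> 'a word list \<times> 'a word list" where
  "word_term w S =
     (if S = {} then [] else [Word (subword (letters w) S)],
      map (\<lambda>J. Word (subword (letters w) J)) (component_list ({1..length (letters w)} - S)))"

definition word_coprod :: "'a word \<Rightarrow> ('a word, 'k::field) tensor2" where
  "word_coprod w = (\<Sum>S\<in>Pow {1..length (letters w)}. basis_vec (word_term w S))"

definition word_coprod_left :: "'a word \<Rightarrow> ('a word, 'k::field) tensor2" where
  "word_coprod_left w = (\<Sum>S\<in>{S \<in> Pow {1..length (letters w)}. 1 \<in> S}. basis_vec (word_term w S))"

abbreviation word_Delta_left :: "'a word list \<Rightarrow> ('a word, 'k::field) tensor2" where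
  "word_Delta_left \<equiv> coprod_left word_coprod word_coprod_left"


section \<open>Decorated non-crossing partitions\<close>

definition noncrossing :: "nat set set \<Rightarrow> bool" where
  "noncrossing L \<longleftrightarrow> \<not> (\<exists>B\<in>L. \<exists>C\<in>L. B \<noteq> C \<and>
     (\<exists>p1\<in>B. \<exists>q1\<in>C. \<exists>p2\<in>B. \<exists>q2\<in>C. p1 < q1 \<and> q1 < p2 \<and> p2 < q2))"

definition NC :: "nat \<Rightarrow> nat set set set" where
  "NC n = {L. partition_on {1..n} L \<and> noncrossing L}"

definition nested_in :: "nat set \<Rightarrow> nat set \<Rightarrow> bool" where
  "nested_in B C \<longleftrightarrow> (\<forall>m\<in>B. Min C < m \<and> m < Max C)"

definition admissible :: "nat set set \<Rightarrow> nat set set \<Rightarrow> bool" where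
  "admissible L Q \<longleftrightarrow> Q \<subseteq> L \<and> \<not> (\<exists>B\<in>Q. \<exists>C\<in>L - Q. nested_in B C)"

text \<open>For finite \<open>X\<close>, \<open>x \<mapsto> card {y \<in> X. y \<le> x}\<close> is the increasing bijection of \<open>X\<close> onto \<open>{1..card X}\<close>.\<close>

definition standardize :: "nat set set \<Rightarrow> nat set set" where
  "standardize P = (\<lambda>B. (\<lambda>x. card {y \<in> \<Union>P. y \<le> x}) ` B) ` P"

typedef 'a nc_word = "{(L :: nat set set, w :: 'a list). w \<noteq> [] \<and> L \<in> NC (length w)}"
  morphisms nc_data NC_Word
proof -
  have "{{1}} \<in> NC 1" by (auto simp: NC_def noncrossing_def partition_on_def)
  then show ?thesis by (intro exI[of _ "({{1}}, [undefined])"]) simp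
qed

definition nc_partition :: "'a nc_word \<Rightarrow> nat set set" where
  "nc_partition w = fst (nc_data w)"

definition nc_letters :: "'a nc_word \<Rightarrow> 'a list" where
  "nc_letters w = snd (nc_data w)"

definition nc_decorations :: "(nat \<times> ('a list \<Rightarrow> 'a nc_word)) set" where
  "nc_decorations = {(n, \<lambda>w. NC_Word (L, w)) | n L. n \<ge> 1 \<and> L \<in> NC n}"

definition nc_term :: "'a nc_word \<Rightarrow> nat set set \<Rightarrow> 'a nc_word list \<times> 'a nc_word list" where
  "nc_term w Q =
     (if Q = {} then [] else [NC_Word (standardize Q, subword (nc_letters w) (\<Union>Q))],
      map (\<lambda>J. NC_Word (standardize {B \<in> nc_partition w - Q. B \<subseteq> J}, subword (nc_letters w) J))
        (component_list ({1..length (nc_letters w)} - \<Union>Q)))"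

definition nc_coprod :: "'a nc_word \<Rightarrow> ('a nc_word, 'k::field) tensor2" where
  "nc_coprod w = (\<Sum>Q\<in>{Q. admissible (nc_partition w) Q}. basis_vec (nc_term w Q))"

definition nc_coprod_left :: "'a nc_word \<Rightarrow> ('a nc_word, 'k::field) tensor2" where
  "nc_coprod_left w =
     (\<Sum>Q\<in>{Q. admissible (nc_partition w) Q \<and> (\<exists>B\<in>Q. 1 \<in> B)}. basis_vec (nc_term w Q))"

abbreviation nc_Delta_left :: "'a nc_word list \<Rightarrow> ('a nc_word, 'k::field) tensor2" where
  "nc_Delta_left \<equiv> coprod_left nc_coprod nc_coprod_left"

definition G_NC :: "('k::field \<Rightarrow> 'a::ab_group_add \<Rightarrow> 'a) \<Rightarrow> (('a nc_word, 'k) tensor \<Rightarrow> 'k) set" where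
  "G_NC scale = characters scale nc_decorations"

definition g_NC :: "('k::field \<Rightarrow> 'a::ab_group_add \<Rightarrow> 'a) \<Rightarrow> (('a nc_word, 'k) tensor \<Rightarrow> 'k) set" where
  "g_NC scale = inf_characters scale nc_decorations"


section \<open>The splitting map\<close>

definition split_word :: "'a word \<Rightarrow> ('a nc_word, 'k::field) tensor" where
  "split_word w = (\<Sum>L\<in>NC (length (letters w)). basis_vec [NC_Word (L, letters w)])"

primrec split_bar :: "'a word list \<Rightarrow> ('a nc_word, 'k::field) tensor" where
  "split_bar [] = tensor_one"
| "split_bar (w # ws) = bar (split_word w) (split_bar ws)"

definition Sp :: "('a word, 'k::field) tensor \<Rightarrow> ('a nc_word, 'k) tensor" where
  "Sp = linear_ext split_bar"

definition Sp_star ::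
  "(('a nc_word, 'k::field) tensor \<Rightarrow> 'k) \<Rightarrow> ('a word, 'k) tensor \<Rightarrow> 'k" where
  "Sp_star f = f \<circ> Sp"

end

theory Submission
  imports Defs
begin

text \<open>
  A form that vanishes on bar words of length different from one sees only those terms of the coproduct
  of a bar word \<open>w|w\<^sub>2|\<dots>|w\<^sub>m\<close> in which the first word alone is cut. For infinitesimal \<open>\<kappa>\<close> the fixed point
  equation \<open>\<Phi> = e + \<kappa> \<prec> \<Phi>\<close> therefore reads
  \<open>\<Phi>(w|w\<^sub>2|\<dots>|w\<^sub>m) = \<Sum>\<^sub>Q \<kappa>(w\<^sub>Q) \<Phi>(w\<^sub>J\<^sub>1|\<dots>|w\<^sub>J\<^sub>k|w\<^sub>2|\<dots>|w\<^sub>m)\<close>, summed over the admissible \<open>Q\<close> containing the block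
  of \<open>1\<close>. The right-hand arguments have smaller degree, so the equation has a unique solution \<open>\<Phi>\<close>, which is
  multiplicative and multilinear by induction on the degree; it equals the half-shuffle exponential.
  Conversely the term of \<open>Q = L\<close> is \<open>\<kappa>(w)\<close> itself, so the equation determines \<open>\<kappa>\<close> recursively from \<open>\<Phi>\<close>.

  For the splitting map, an admissible decomposition \<open>L = Q \<squnion> U\<close> of some \<open>L \<in> NC\<^sub>n\<close> is the same thing as
  a subset \<open>S = \<Union>Q\<close> of \<open>[n]\<close>, a non-crossing partition of \<open>S\<close>, and a non-crossing partition of each
  component of \<open>[n] \<setminus> S\<close>: no block of \<open>U\<close> can jump over a point of \<open>S\<close> without crossing. Summing the
  recursion over all \<open>L\<close> thus turns it into the recursion for words.
\<close>

section \<open>Linear forms on free vector spaces\<close>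

lemma lookup_fscale [simp]: "Poly_Mapping.lookup (fscale c v) x = c * Poly_Mapping.lookup v x"
  unfolding fscale_def by transfer (simp add: when_def)

lemma fscale_single [simp]: "fscale c (Poly_Mapping.single x a) = Poly_Mapping.single x (c * a)"
  by (rule poly_mapping_eqI) (simp add: lookup_single when_def)

interpretation free: vector_space fscale
  by unfold_locales (auto intro!: poly_mapping_eqI simp: lookup_add algebra_simps)

abbreviation is_form :: "(('x \<Rightarrow>\<^sub>0 'k::field) \<Rightarrow> 'k) \<Rightarrow> bool" where
  "is_form f \<equiv> Vector_Spaces.linear fscale (*) f"

lemma is_form_iff:
  fixes f :: "('x \<Rightarrow>\<^sub>0 'k::field) \<Rightarrow> 'k"
  shows "is_form f \<longleftrightarrow> (\<forall>u v. f (u + v) = f u + f v) \<and> (\<forall>c v. f (fscale c v) = c * f v)"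
proof -
  have "vector_space ((*) :: 'k \<Rightarrow> 'k \<Rightarrow> 'k)"
    by unfold_locales (auto simp: algebra_simps)
  then show ?thesis
    unfolding Vector_Spaces.linear_iff by (simp add: free.vector_space_axioms)
qed

lemma is_formI:
  assumes "\<And>u v. f (u + v) = f u + f v" "\<And>c v. f (fscale c v) = c * f v"
  shows "is_form f"
  using assms by (simp add: is_form_iff)

lemma
  assumes "is_form f"
  shows form_add: "f (u + v) = f u + f v"
    and form_scale: "f (fscale c v) = c * f v"
    and form_zero: "f 0 = 0"
    and form_diff: "f (u - v) = f u - f v"
    and form_sum: "f (\<Sum>i\<in>I. h i) = (\<Sum>i\<in>I. f (h i))"
    and form_single: "f (Poly_Mapping.single x c) = c * f (basis_vec x)"
proof -
  interpret Vector_Spaces.linear fscale "(*)" f by fact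
  show "f (u + v) = f u + f v" "f (fscale c v) = c * f v" "f 0 = 0" "f (u - v) = f u - f v"
    "f (\<Sum>i\<in>I. h i) = (\<Sum>i\<in>I. f (h i))"
    by (rule add scale zero diff sum)+
  show "f (Poly_Mapping.single x c) = c * f (basis_vec x)"
    using scale[of c "basis_vec x"] by simp
qed

section \<open>Forms given by their values on basis vectors\<close>

definition eval_form :: "('x \<Rightarrow> 'k) \<Rightarrow> ('x \<Rightarrow>\<^sub>0 'k::field) \<Rightarrow> 'k" where
  "eval_form h v = (\<Sum>x\<in>Poly_Mapping.keys v. Poly_Mapping.lookup v x * h x)"

lemma eval_form_superset:
  assumes "finite X" "Poly_Mapping.keys v \<subseteq> X"
  shows "eval_form h v = (\<Sum>x\<in>X. Poly_Mapping.lookup v x * h x)"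
  unfolding eval_form_def
  by (rule sum.mono_neutral_left) (use assms in \<open>auto simp: in_keys_iff\<close>)

lemma is_form_eval_form [simp]:
  fixes h :: "'x \<Rightarrow> 'k::field"
  shows "is_form (eval_form h)"
proof (rule is_formI)
  fix u v :: "'x \<Rightarrow>\<^sub>0 'k"
  let ?X = "Poly_Mapping.keys u \<union> Poly_Mapping.keys v"
  have "Poly_Mapping.keys (u + v) \<subseteq> ?X" by (rule Poly_Mapping.keys_add)
  then show "eval_form h (u + v) = eval_form h u + eval_form h v"
    by (simp add: eval_form_superset[of ?X] lookup_add algebra_simps sum.distrib)
next
  fix c and v :: "'x \<Rightarrow>\<^sub>0 'k"
  have "Poly_Mapping.keys (fscale c v) \<subseteq> Poly_Mapping.keys v" by (auto simp: in_keys_iff)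
  then show "eval_form h (fscale c v) = c * eval_form h v"
    by (simp add: eval_form_superset[of "Poly_Mapping.keys v"] sum_distrib_left mult.assoc)
qed

lemma eval_form_basis [simp]: "eval_form h (basis_vec x) = h x"
  by (simp add: eval_form_def)

lemma basis_expansion:
  "v = (\<Sum>x\<in>Poly_Mapping.keys v. fscale (Poly_Mapping.lookup v x) (basis_vec x))"
  by (rule poly_mapping_eqI)
    (simp add: lookup_sum lookup_single when_def in_keys_iff if_distrib sum.delta cong: if_cong)

lemma form_eq_eval_form:
  assumes "is_form f"
  shows "f v = eval_form (\<lambda>x. f (basis_vec x)) v"
proof -
  have "f v = f (\<Sum>x\<in>Poly_Mapping.keys v. fscale (Poly_Mapping.lookup v x) (basis_vec x))"
    by (rule arg_cong[OF basis_expansion])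
  also have "\<dots> = eval_form (\<lambda>x. f (basis_vec x)) v"
    unfolding form_sum[OF assms] form_scale[OF assms] eval_form_def ..
  finally show ?thesis .
qed

lemma form_eqI:
  assumes "is_form f" "is_form g" "\<And>x. f (basis_vec x) = g (basis_vec x)"
  shows "f = g"
proof
  fix v
  show "f v = g v"
    by (subst form_eq_eval_form[OF assms(1)], subst form_eq_eval_form[OF assms(2)]) (simp add: assms(3))
qed

lemma form_linear_ext:
  assumes "is_form f"
  shows "f (linear_ext h v) = eval_form (\<lambda>x. f (h x)) v"
  unfolding linear_ext_def eval_form_def by (simp add: form_sum[OF assms] form_scale[OF assms])

lemma form_bilinear_ext:
  assumes "is_form f"
  shows "f (bilinear_ext m u v) = eval_form (\<lambda>x. eval_form (\<lambda>y. f (basis_vec (m x y))) v) u"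
  unfolding bilinear_ext_def eval_form_def form_sum[OF assms]
  by (subst form_single[OF assms]) (simp add: sum_distrib_left mult.assoc)

lemma is_form_lookup [simp]: "is_form (\<lambda>v. Poly_Mapping.lookup v x)"
  by (rule is_formI) (simp_all add: lookup_add)

lemma is_form_unit_form [simp]: "is_form unit_form"
  unfolding unit_form_def[abs_def] by simp

lemma unit_form_basis: "unit_form (basis_vec ws) = (if ws = [] then 1 else 0)"
  by (simp add: unit_form_def lookup_single when_def)

lemma is_form_plus: "is_form f \<Longrightarrow> is_form g \<Longrightarrow> is_form (\<lambda>v. f v + g v)"
  by (rule is_formI) (simp_all add: form_add form_scale algebra_simps)

section \<open>Forms on bar products and on tensor products\<close>

lemma tensor_forms_eval:
  "tensor_forms f g = eval_form (\<lambda>(x, y). f (basis_vec x) * g (basis_vec y))"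
  by (auto simp: tensor_forms_def eval_form_def intro!: ext sum.cong)

lemma form_bar:
  assumes "is_form f"
  shows "f (bar u v) = eval_form (\<lambda>x. eval_form (\<lambda>y. f (basis_vec (x @ y))) v) u"
  unfolding bar_def by (rule form_bilinear_ext[OF assms])

lemma bar_basis [simp]: "bar (basis_vec u) (basis_vec v) = basis_vec (u @ v)"
  by (simp add: bar_def bilinear_ext_def)

text \<open>Turns the evaluation of a product of tensors into an iterated one, so that the coproduct
  of a bar word can be treated one word at a time.\<close>

lemma eval_form_bar2:
  "eval_form h (bar2 u v) =
     eval_form (\<lambda>(a, b). eval_form (\<lambda>(c, d). h (a @ c, b @ d)) v) u"
  unfolding bar2_def form_bilinear_ext[OF is_form_eval_form]
  by (intro arg_cong2[where f = eval_form] ext) (auto intro!: arg_cong2[where f = eval_form])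

lemma eval_form_mult_left: "eval_form (\<lambda>x. c * h x) v = c * eval_form h v"
  by (simp add: eval_form_def sum_distrib_left algebra_simps)

lemma eval_form_mult_right: "eval_form (\<lambda>x. h x * c) v = eval_form h v * c"
  by (simp add: eval_form_def sum_distrib_right mult.assoc)

lemma form_bar_multiplicative:
  assumes "is_form f" "\<And>u v. f (basis_vec (u @ v)) = f (basis_vec u) * f (basis_vec v)"
  shows "f (bar x y) = f x * f y"
  unfolding form_bar[OF assms(1)] assms(2) eval_form_mult_left eval_form_mult_right
  by (simp add: form_eq_eval_form[OF assms(1), symmetric])

section \<open>Forms on the quotient and multilinearity in the letters\<close>

lemma respects_tensor_cong_iff:
  assumes "is_form f"
  shows "f respects tensor_cong scale M \<longleftrightarrow> (\<forall>r\<in>tensor_relations scale M. f r = 0)"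
proof
  assume *: "f respects tensor_cong scale M"
  show "\<forall>r\<in>tensor_relations scale M. f r = 0"
  proof
    fix r assume "r \<in> tensor_relations scale M"
    then have "(r, 0) \<in> tensor_cong scale M"
      by (simp add: tensor_cong_def free.span_base)
    with * have "f r = f 0" by (auto simp: congruent_def)
    then show "f r = 0" by (simp add: form_zero[OF assms])
  qed
next
  assume *: "\<forall>r\<in>tensor_relations scale M. f r = 0"
  have "f r = 0" if "r \<in> free.span (tensor_relations scale M)" for r
    using that
  proof (induction rule: free.span_induct_alt)
    case base then show ?case by (simp add: form_zero[OF assms])
  next
    case (step c x y) then show ?case
      using * by (simp add: form_add[OF assms] form_scale[OF assms])
  qed
  then show "f respects tensor_cong scale M"
    using form_diff[OF assms] by (auto simp: congruent_def tensor_cong_def) (metis eq_iff_diff_eq_0)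
qed

text \<open>Stated with list updates because changing one letter of a word changes at most one
  letter of a subword, at a fixed position (\<open>subword_update_in\<close>). Only lists of length
  \<open>n\<close> are constrained, since each decoration belongs to one length.\<close>

definition multilinear :: "('k::field \<Rightarrow> 'a::ab_group_add \<Rightarrow> 'a) \<Rightarrow> nat \<Rightarrow> ('a list \<Rightarrow> 'k) \<Rightarrow> bool" where
  "multilinear scale n F \<longleftrightarrow> (\<forall>a i x y c. length a = n \<longrightarrow> i < n \<longrightarrow>
     F (a[i := x + y]) = F (a[i := x]) + F (a[i := y]) \<and> F (a[i := scale c x]) = c * F (a[i := x]))"

text \<open>Translates list updates into the shape \<open>p @ x # q\<close> in which the relations
  of the tensor algebra are written.\<close>

lemma multilinear_iff_split:
  fixes scale :: "'k::field \<Rightarrow> 'a::ab_group_add \<Rightarrow> 'a"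
  shows "multilinear scale n F \<longleftrightarrow> (\<forall>p q x y c. length p + 1 + length q = n \<longrightarrow>
     F (p @ (x + y) # q) = F (p @ x # q) + F (p @ y # q) \<and> F (p @ scale c x # q) = c * F (p @ x # q))"
  (is "_ \<longleftrightarrow> ?R")
proof
  assume L: "multilinear scale n F"
  show ?R
  proof (intro allI impI)
    fix p q :: "'a list" and x y c assume "length p + 1 + length q = n"
    then show "F (p @ (x + y) # q) = F (p @ x # q) + F (p @ y # q) \<and> F (p @ scale c x # q) = c * F (p @ x # q)"
      using L[unfolded multilinear_def, rule_format, of "p @ x # q" "length p" x y c] by simp
  qed
next
  assume R: ?R
  show "multilinear scale n F"
    unfolding multilinear_def
  proof (intro allI impI)
    fix a :: "'a list" and i x y c assume "length a = n" "i < n"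
    then show "F (a[i := x + y]) = F (a[i := x]) + F (a[i := y]) \<and> F (a[i := scale c x]) = c * F (a[i := x])"
      using R[rule_format, of "take i a" "drop (Suc i) a" x y c] by (simp add: upd_conv_take_nth_drop)
  qed
qed

text \<open>The two families of relations are additivity and homogeneity in a single letter, with
  arbitrary bar words \<open>u\<close> and \<open>v\<close> around the word concerned. A form
  descends to the quotient iff it kills both families.\<close>

lemma linear_forms_iff:
  fixes scale :: "'k::field \<Rightarrow> 'a::ab_group_add \<Rightarrow> 'a"
  shows "f \<in> linear_forms scale M \<longleftrightarrow> is_form f \<and>
     (\<forall>(n, mk)\<in>M. \<forall>u v. multilinear scale n (\<lambda>a. f (basis_vec (u @ mk a # v))))"
proof (cases "is_form f")
  case True
  have "(\<forall>r\<in>tensor_relations scale M. f r = 0) \<longleftrightarrow>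
     (\<forall>(n, mk)\<in>M. \<forall>u v. multilinear scale n (\<lambda>a. f (basis_vec (u @ mk a # v))))" (is "?L \<longleftrightarrow> ?R")
  proof
    assume L: ?L
    show ?R
      unfolding multilinear_iff_split
    proof (intro ballI allI impI, clarify, intro allI impI conjI)
      fix mk u v and p q :: "'a list" and x y c
      assume M: "(length p + 1 + length q, mk) \<in> M"
      have "basis_vec (u @ mk (p @ (x + y) # q) # v)
        - basis_vec (u @ mk (p @ x # q) # v) - basis_vec (u @ mk (p @ y # q) # v) \<in> tensor_relations scale M"
        unfolding tensor_relations_def using M by blast
      from bspec[OF L this] show "f (basis_vec (u @ mk (p @ (x + y) # q) # v)) =
        f (basis_vec (u @ mk (p @ x # q) # v)) + f (basis_vec (u @ mk (p @ y # q) # v))"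
        by (simp add: form_diff[OF True] diff_eq_eq add.commute)
      have "basis_vec (u @ mk (p @ scale c x # q) # v) - fscale c (basis_vec (u @ mk (p @ x # q) # v))
         \<in> tensor_relations scale M"
        unfolding tensor_relations_def using M by blast
      from bspec[OF L this] show "f (basis_vec (u @ mk (p @ scale c x # q) # v)) =
        c * f (basis_vec (u @ mk (p @ x # q) # v))"
        by (simp add: form_diff[OF True] form_scale[OF True] del: fscale_single)
    qed
  next
    assume R: ?R
    have R': "f (basis_vec (u @ mk (p @ (x + y) # q) # v)) =
        f (basis_vec (u @ mk (p @ x # q) # v)) + f (basis_vec (u @ mk (p @ y # q) # v)) \<and>
        f (basis_vec (u @ mk (p @ scale c x # q) # v)) = c * f (basis_vec (u @ mk (p @ x # q) # v))"
      if "(length p + 1 + length q, mk) \<in> M" for u v p q x y c mk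
      using R that unfolding multilinear_iff_split by blast
    show ?L
      unfolding tensor_relations_def
      by (auto simp: R' form_diff[OF True] form_scale[OF True] simp del: fscale_single)
  qed
  with True show ?thesis
    by (simp add: linear_forms_def respects_tensor_cong_iff[OF True])
qed (simp add: linear_forms_def)

section \<open>Characters and infinitesimal characters on basis bar words\<close>

lemma characters_iff:
  "\<Phi> \<in> characters scale M \<longleftrightarrow> \<Phi> \<in> linear_forms scale M \<and> \<Phi> tensor_one = 1 \<and>
     (\<forall>u v. \<Phi> (basis_vec (u @ v)) = \<Phi> (basis_vec u) * \<Phi> (basis_vec v))" (is "?L \<longleftrightarrow> ?R")
proof
  assume L: ?L
  have "\<Phi> (basis_vec (u @ v)) = \<Phi> (basis_vec u) * \<Phi> (basis_vec v)" for u v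
  \<comment> \<open>The definition speaks of the augmentation ideal only; when one of the words is
    empty, the identity comes from \<open>\<Phi> tensor_one = 1\<close>.\<close>
  proof (cases "u = [] \<or> v = []")
    case False
    then have "basis_vec u \<in> augmentation_ideal" "basis_vec v \<in> augmentation_ideal"
      by (auto simp: augmentation_ideal_def lookup_single)
    with L have "\<Phi> (bar (basis_vec u) (basis_vec v)) = \<Phi> (basis_vec u) * \<Phi> (basis_vec v)"
      unfolding characters_def by blast
    then show ?thesis by simp
  qed (use L in \<open>auto simp: characters_def\<close>)
  with L show ?R by (auto simp: characters_def)
next
  assume R: ?R
  then have "is_form \<Phi>" by (simp add: linear_forms_def)
  with R show ?L by (auto simp: characters_def intro!: form_bar_multiplicative)
qed

text \<open>Both conditions on an infinitesimal character in one: the empty bar word is the unit,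
  and a bar word of length at least two is a product of two elements of the augmentation ideal. The
  congruence is left out, so that the half-shuffle recursion can be treated without reference to
  letters.\<close>

definition infinitesimal :: "(('x, 'k::field) tensor \<Rightarrow> 'k) \<Rightarrow> bool" where
  "infinitesimal \<kappa> \<longleftrightarrow> is_form \<kappa> \<and> (\<forall>ws. length ws \<noteq> 1 \<longrightarrow> \<kappa> (basis_vec ws) = 0)"

lemma infinitesimal_bar:
  assumes "infinitesimal \<kappa>" "a \<in> augmentation_ideal" "b \<in> augmentation_ideal"
  shows "\<kappa> (bar a b) = 0"
proof -
  have "\<kappa> (basis_vec (x @ y)) = 0" if "x \<in> Poly_Mapping.keys a" "y \<in> Poly_Mapping.keys b" for x y
  proof -
    have "x \<noteq> []" "y \<noteq> []"
      using that assms(2,3) by (auto simp: augmentation_ideal_def in_keys_iff)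
    then have "length (x @ y) \<noteq> 1"
      by (cases x; cases y) auto
    then show ?thesis using assms(1) by (simp add: infinitesimal_def)
  qed
  then show ?thesis
    using assms(1) by (simp add: infinitesimal_def form_bar eval_form_def)
qed

lemma inf_characters_iff:
  "\<kappa> \<in> inf_characters scale M \<longleftrightarrow> \<kappa> \<in> linear_forms scale M \<and> infinitesimal \<kappa>" (is "?L \<longleftrightarrow> ?R")
proof
  assume L: ?L
  have "\<kappa> (basis_vec ws) = 0" if len: "length ws \<noteq> 1" for ws
  proof (cases ws)
    case Nil then show ?thesis using L by (simp add: inf_characters_def)
  next
    case (Cons w v)
    with len have "basis_vec [w] \<in> augmentation_ideal" "basis_vec v \<in> augmentation_ideal"
      by (auto simp: augmentation_ideal_def lookup_single)
    with L have "\<kappa> (bar (basis_vec [w]) (basis_vec v)) = 0"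
      unfolding inf_characters_def by blast
    then show ?thesis using Cons by simp
  qed
  with L show ?R by (auto simp: inf_characters_def infinitesimal_def linear_forms_def)
next
  assume R: ?R
  then show ?L by (auto simp: inf_characters_def infinitesimal_bar) (simp add: infinitesimal_def)
qed

section \<open>The half-shuffle exponential of an infinitesimal form\<close>

lemma is_form_prec:
  assumes "is_form f"
  shows "is_form (prec \<Delta>l f g)"
proof -
  have T: "is_form (tensor_forms f g)" by (simp add: tensor_forms_eval)
  have *: "prec \<Delta>l f g =
    (\<lambda>v. eval_form (\<lambda>x. tensor_forms f g (\<Delta>l x)) v + g tensor_one * (f v - f tensor_one * unit_form v))"
    by (simp add: prec_def[abs_def] form_linear_ext[OF T])
  show ?thesis
    unfolding * using assms
    by (intro is_formI) (simp_all add: form_add form_scale[where f = "eval_form h" for h]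
        form_scale[where f = unit_form] form_scale[OF assms] algebra_simps)
qed

lemma prec_basis:
  "prec \<Delta>l f g (basis_vec ws) = tensor_forms f g (\<Delta>l ws)
     + g tensor_one * (f (basis_vec ws) - f tensor_one * unit_form (basis_vec ws))"
  by (simp add: prec_def linear_ext_def)

text \<open>
  The index sets enumerate the terms \<open>a\<^sub>Q \<otimes> a\<^sub>J\<^sub>1|\<dots>|a\<^sub>J\<^sub>k\<close> of the coproduct with \<open>Q \<noteq> {}\<close>; the term with
  empty \<open>Q\<close> is \<open>\<one> \<otimes> w\<close>.
\<close>

locale half_shuffle =
  fixes D Dl :: "'x \<Rightarrow> ('x, 'k::field) tensor2"
    and idx idxl :: "'x \<Rightarrow> 'i set"
    and lft :: "'x \<Rightarrow> 'i \<Rightarrow> 'x"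
    and rgt :: "'x \<Rightarrow> 'i \<Rightarrow> 'x list"
    and deg :: "'x \<Rightarrow> nat"
  assumes D_eq: "D w = basis_vec ([], [w]) + (\<Sum>q\<in>idx w. basis_vec ([lft w q], rgt w q))"
    and Dl_eq: "Dl w = (\<Sum>q\<in>idxl w. basis_vec ([lft w q], rgt w q))"
    and deg_rgt: "q \<in> idxl w \<Longrightarrow> sum_list (map deg (rgt w q)) < deg w"
begin

abbreviation (input) \<Delta>l :: "'x list \<Rightarrow> ('x, 'k) tensor2" where
  "\<Delta>l \<equiv> coprod_left D Dl"

definition tdeg :: "'x list \<Rightarrow> nat" where
  "tdeg ws = sum_list (map deg ws)"

lemma tdeg_append [simp]: "tdeg (u @ v) = tdeg u + tdeg v"
  by (simp add: tdeg_def)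

lemma tdeg_rgt: "q \<in> idxl w \<Longrightarrow> tdeg (rgt w q @ ws) < tdeg (w # ws)"
  using deg_rgt by (simp add: tdeg_def)

text \<open>If a later word puts anything on the left, \<open>l @ a\<close> has length at least two
  and \<kappa> kills it. So each \<open>D w\<close> contributes only its term
  \<open>([], [w])\<close>, which moves \<open>w\<close> unchanged to the right. The accumulators
  \<open>l\<close> and \<open>r\<close> hold what earlier words have produced.\<close>

lemma eval_coprod_infinitesimal:
  assumes "infinitesimal \<kappa>" "l \<noteq> []"
  shows "eval_form (\<lambda>(a, b). \<kappa> (basis_vec (l @ a)) * g (basis_vec (r @ b))) (coprod D ws) =
    \<kappa> (basis_vec l) * g (basis_vec (r @ ws))"
  using assms(2)
proof (induction ws arbitrary: l r)
  case Nil
  then show ?case by simp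
next
  case (Cons w ws)
  have "\<kappa> (basis_vec (l @ [x])) = 0" for x
    using assms(1) Cons.prems by (simp add: infinitesimal_def)
  then have "eval_form (\<lambda>(a, b). \<kappa> (basis_vec (l @ a)) * g (basis_vec ((r @ b) @ ws))) (D w) =
    \<kappa> (basis_vec l) * g (basis_vec (r @ w # ws))"
    unfolding D_eq[of w] form_add[OF is_form_eval_form] form_sum[OF is_form_eval_form] by simp
  moreover have "eval_form (\<lambda>(a, b). \<kappa> (basis_vec (l @ a)) * g (basis_vec (r @ b))) (coprod D (w # ws)) =
      eval_form (\<lambda>(a, b). eval_form (\<lambda>(c, d). \<kappa> (basis_vec ((l @ a) @ c)) * g (basis_vec ((r @ b) @ d)))
        (coprod D ws)) (D w)"
    by (simp add: eval_form_bar2)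
  moreover have "\<dots> = eval_form (\<lambda>(a, b). \<kappa> (basis_vec (l @ a)) * g (basis_vec ((r @ b) @ ws))) (D w)"
    using Cons.prems by (subst Cons.IH) simp_all
  ultimately show ?case
    by (simp only:)
qed

text \<open>Both summands of \<open>prec\<close> vanish at the unit: \<open>coprod_left\<close> is 0
  there, and the correction subtracts \<open>f tensor_one\<close> from itself.\<close>

lemma prec_Nil: "prec \<Delta>l f g tensor_one = 0"
  by (simp add: prec_basis unit_form_basis) (simp add: tensor_forms_def)

text \<open>The term \<open>basis_vec (w # ws, [])\<close> subtracted in \<open>coprod_left\<close>
  costs \<kappa>(\<open>w # ws\<close>) times the value of \<open>g\<close> at the unit, and the
  second summand of \<open>prec\<close> gives exactly this back. What remains is the sum over the
  unreduced left coproduct of the first word.\<close>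

lemma prec_Cons:
  assumes "infinitesimal \<kappa>"
  shows "prec \<Delta>l \<kappa> g (basis_vec (w # ws)) =
    (\<Sum>q\<in>idxl w. \<kappa> (basis_vec [lft w q]) * g (basis_vec (rgt w q @ ws)))"
proof -
  have "tensor_forms \<kappa> g (bar2 (Dl w) (coprod D ws)) =
    eval_form (\<lambda>(l, r). eval_form (\<lambda>(a, b). \<kappa> (basis_vec (l @ a)) * g (basis_vec (r @ b))) (coprod D ws)) (Dl w)"
    by (simp add: tensor_forms_eval eval_form_bar2)
  also have "\<dots> = (\<Sum>q\<in>idxl w. \<kappa> (basis_vec [lft w q]) * g (basis_vec (rgt w q @ ws)))"
    unfolding Dl_eq[of w] form_sum[OF is_form_eval_form] eval_form_basis prod.case
    by (intro sum.cong refl eval_coprod_infinitesimal[OF assms]) simp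
  finally show ?thesis
    by (simp add: prec_basis unit_form_basis tensor_forms_eval form_diff[OF is_form_eval_form])
qed

section \<open>Finiteness, recursion, uniqueness and multiplicativity of the exponential\<close>

context
  fixes \<kappa> :: "('x, 'k) tensor \<Rightarrow> 'k"
  assumes inf: "infinitesimal \<kappa>"
begin

lemma is_form_prec_power: "is_form (prec_power \<Delta>l \<kappa> n)"
  using inf by (cases n) (auto simp: infinitesimal_def intro: is_form_prec)

text \<open>Each half-shuffle by \<kappa> passes to arguments of strictly smaller degree, so the
  degree bounds the number of factors that can act.\<close>

lemma prec_power_eq_0: "tdeg ws < n \<Longrightarrow> prec_power \<Delta>l \<kappa> n (basis_vec ws) = 0"
proof (induction n arbitrary: ws)
  case (Suc n)
  show ?case
  proof (cases ws)
    case Nil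
    then show ?thesis by (simp add: prec_Nil)
  next
    case (Cons w ws')
    have "prec_power \<Delta>l \<kappa> n (basis_vec (rgt w q @ ws')) = 0" if "q \<in> idxl w" for q
      using Suc tdeg_rgt[OF that, of ws'] Cons by (intro Suc.IH) simp
    then show ?thesis
      using Cons by (simp add: prec_Cons[OF inf])
  qed
qed simp

text \<open>\<open>Sum_any\<close> is the sum over the indices with nonzero value when these are
  finite in number. A bound on the degrees of the bar words in \<open>v\<close> confines them to an
  initial segment.\<close>

lemma prec_exp_bounded:
  assumes "\<And>ws. ws \<in> Poly_Mapping.keys v \<Longrightarrow> tdeg ws \<le> N"
  shows "prec_exp \<Delta>l \<kappa> v = (\<Sum>n\<le>N. prec_power \<Delta>l \<kappa> n v)"
  unfolding prec_exp_def
proof (rule Sum_any.expand_superset)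
  have "prec_power \<Delta>l \<kappa> n v = 0" if "n > N" for n
    using that assms
    by (subst form_eq_eval_form[OF is_form_prec_power])
      (fastforce simp: eval_form_def intro!: sum.neutral prec_power_eq_0)
  then show "{n. prec_power \<Delta>l \<kappa> n v \<noteq> 0} \<subseteq> {..N}"
    by (auto simp: not_less[symmetric])
qed simp

lemma is_form_prec_exp: "is_form (prec_exp \<Delta>l \<kappa>)"
proof -
  have bd: "\<exists>N. \<forall>ws\<in>Poly_Mapping.keys v. tdeg ws \<le> N" for v :: "('x, 'k) tensor"
    using finite_nat_set_iff_bounded_le[of "tdeg ` Poly_Mapping.keys v"] by auto
  show ?thesis
  proof (rule is_formI)
    fix u v :: "('x, 'k) tensor"
    \<comment> \<open>Additivity is read off finite sums, so a single truncation has to serve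
      \<open>u\<close>, \<open>v\<close> and \<open>u + v\<close>.\<close>
    obtain M N where "\<forall>ws\<in>Poly_Mapping.keys u. tdeg ws \<le> M" "\<forall>ws\<in>Poly_Mapping.keys v. tdeg ws \<le> N"
      using bd by meson
    then have "\<forall>ws\<in>Poly_Mapping.keys u. tdeg ws \<le> max M N" "\<forall>ws\<in>Poly_Mapping.keys v. tdeg ws \<le> max M N"
      "\<forall>ws\<in>Poly_Mapping.keys (u + v). tdeg ws \<le> max M N"
      using Poly_Mapping.keys_add[of u v] by fastforce+
    then show "prec_exp \<Delta>l \<kappa> (u + v) = prec_exp \<Delta>l \<kappa> u + prec_exp \<Delta>l \<kappa> v"
      by (simp add: prec_exp_bounded[of _ "max M N"] form_add[OF is_form_prec_power] sum.distrib)
  next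
    fix c and v :: "('x, 'k) tensor"
    obtain N where "\<forall>ws\<in>Poly_Mapping.keys v. tdeg ws \<le> N"
      using bd by meson
    moreover from this have "\<forall>ws\<in>Poly_Mapping.keys (fscale c v). tdeg ws \<le> N"
      by (auto simp: in_keys_iff)
    ultimately show "prec_exp \<Delta>l \<kappa> (fscale c v) = c * prec_exp \<Delta>l \<kappa> v"
      by (simp add: prec_exp_bounded[of _ N] form_scale[OF is_form_prec_power] sum_distrib_left)
  qed
qed

lemma prec_exp_Nil: "prec_exp \<Delta>l \<kappa> tensor_one = 1"
  by (subst prec_exp_bounded[of _ 0]) (simp_all add: tdeg_def unit_form_basis)

lemma prec_exp_Cons:
  "prec_exp \<Delta>l \<kappa> (basis_vec (w # ws)) =
    (\<Sum>q\<in>idxl w. \<kappa> (basis_vec [lft w q]) * prec_exp \<Delta>l \<kappa> (basis_vec (rgt w q @ ws)))"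
proof -
  let ?N = "tdeg (w # ws)"
  \<comment> \<open>The truncation is one larger than the degree: the term for 0 is the counit,
    which vanishes on a nonempty bar word, and after the shift \<open>?N\<close> still bounds the
    degrees of all right-hand bar words.\<close>
  have "prec_exp \<Delta>l \<kappa> (basis_vec (w # ws)) = (\<Sum>n\<le>Suc ?N. prec_power \<Delta>l \<kappa> n (basis_vec (w # ws)))"
    by (rule prec_exp_bounded) simp
  also have "\<dots> = (\<Sum>n\<le>?N. prec_power \<Delta>l \<kappa> (Suc n) (basis_vec (w # ws)))"
    by (simp add: sum.atMost_Suc_shift unit_form_basis del: prec_power.simps(2) sum.atMost_Suc)
  also have "\<dots> = (\<Sum>n\<le>?N. \<Sum>q\<in>idxl w. \<kappa> (basis_vec [lft w q]) * prec_power \<Delta>l \<kappa> n (basis_vec (rgt w q @ ws)))"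
    by (simp add: prec_Cons[OF inf])
  also have "\<dots> = (\<Sum>q\<in>idxl w. \<kappa> (basis_vec [lft w q]) * (\<Sum>n\<le>?N. prec_power \<Delta>l \<kappa> n (basis_vec (rgt w q @ ws))))"
    by (subst sum.swap) (simp add: sum_distrib_left)
  also have "\<dots> = (\<Sum>q\<in>idxl w. \<kappa> (basis_vec [lft w q]) * prec_exp \<Delta>l \<kappa> (basis_vec (rgt w q @ ws)))"
    using tdeg_rgt[of _ w ws] by (intro sum.cong refl) (subst prec_exp_bounded[of _ ?N], auto simp: less_imp_le)
  finally show ?thesis .
qed

text \<open>The recursion refers only to bar words of smaller degree, so together with the value at
  the unit it fixes the form.\<close>

lemma prec_exp_unique:
  assumes "is_form \<Phi>" "\<Phi> tensor_one = 1"
    "\<And>w ws. \<Phi> (basis_vec (w # ws)) =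
      (\<Sum>q\<in>idxl w. \<kappa> (basis_vec [lft w q]) * \<Phi> (basis_vec (rgt w q @ ws)))"
  shows "\<Phi> = prec_exp \<Delta>l \<kappa>"
proof (rule form_eqI[OF assms(1) is_form_prec_exp])
  fix ws
  show "\<Phi> (basis_vec ws) = prec_exp \<Delta>l \<kappa> (basis_vec ws)"
  proof (induction ws rule: measure_induct_rule[of tdeg])
    case (less ws)
    show ?case
    proof (cases ws)
      case Nil
      then show ?thesis by (simp add: assms(2) prec_exp_Nil)
    next
      case (Cons w ws')
      then show ?thesis
        using less tdeg_rgt by (simp add: assms(3) prec_exp_Cons)
    qed
  qed
qed

text \<open>Compared on basis vectors, the equation has two cases: at the unit the half-shuffle
  vanishes and leaves 1, on a nonempty bar word the counit vanishes and leaves the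
  recursion.\<close>

lemma fixed_point_iff:
  assumes "is_form \<Phi>"
  shows "\<Phi> = (\<lambda>v. unit_form v + prec \<Delta>l \<kappa> \<Phi> v) \<longleftrightarrow> \<Phi> tensor_one = 1 \<and>
    (\<forall>w ws. \<Phi> (basis_vec (w # ws)) =
      (\<Sum>q\<in>idxl w. \<kappa> (basis_vec [lft w q]) * \<Phi> (basis_vec (rgt w q @ ws))))"
    (is "?L \<longleftrightarrow> ?R")
proof
  assume ?L
  then have *: "\<Phi> v = unit_form v + prec \<Delta>l \<kappa> \<Phi> v" for v by (rule fun_cong)
  have "\<Phi> tensor_one = 1"
    by (subst *) (simp add: unit_form_basis prec_Nil)
  moreover have "\<Phi> (basis_vec (w # ws)) =
      (\<Sum>q\<in>idxl w. \<kappa> (basis_vec [lft w q]) * \<Phi> (basis_vec (rgt w q @ ws)))" for w ws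
    by (subst *) (simp add: unit_form_basis prec_Cons[OF inf])
  ultimately show ?R by blast
next
  assume R: ?R
  have "is_form \<kappa>" using inf by (simp add: infinitesimal_def)
  show ?L
  proof (rule form_eqI[OF assms])
    show "is_form (\<lambda>v. unit_form v + prec \<Delta>l \<kappa> \<Phi> v)"
      using \<open>is_form \<kappa>\<close> by (intro is_form_plus is_form_prec) simp_all
    show "\<Phi> (basis_vec ws) = unit_form (basis_vec ws) + prec \<Delta>l \<kappa> \<Phi> (basis_vec ws)" for ws
      using R by (cases ws) (simp_all add: unit_form_basis prec_Nil prec_Cons[OF inf])
  qed
qed

lemma fixed_point_iff_prec_exp:
  assumes "is_form \<Phi>"
  shows "\<Phi> = (\<lambda>v. unit_form v + prec \<Delta>l \<kappa> \<Phi> v) \<longleftrightarrow> \<Phi> = prec_exp \<Delta>l \<kappa>"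
  unfolding fixed_point_iff[OF assms]
  using prec_exp_unique[OF assms] prec_exp_Nil prec_exp_Cons by blast

text \<open>The recursion cuts the first word only and carries \<open>v\<close> along as a tail.
  Induction on the degree of \<open>u\<close> therefore splits off the factor of \<open>v\<close> in
  every summand.\<close>

lemma prec_exp_append:
  "prec_exp \<Delta>l \<kappa> (basis_vec (u @ v)) = prec_exp \<Delta>l \<kappa> (basis_vec u) * prec_exp \<Delta>l \<kappa> (basis_vec v)"
proof (induction u rule: measure_induct_rule[of tdeg])
  case (less u)
  show ?case
  proof (cases u)
    case Nil
    then show ?thesis by (simp add: prec_exp_Nil)
  next
    case (Cons w u')
    have "prec_exp \<Delta>l \<kappa> (basis_vec ((rgt w q @ u') @ v)) =
      prec_exp \<Delta>l \<kappa> (basis_vec (rgt w q @ u')) * prec_exp \<Delta>l \<kappa> (basis_vec v)" if "q \<in> idxl w" for q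
      by (rule less) (use tdeg_rgt[OF that] Cons in simp)
    then show ?thesis
      using Cons by (simp add: prec_exp_Cons sum_distrib_right mult.assoc)
  qed
qed

end

end

section \<open>Components and subwords\<close>

lemma is_interval_Icc: "x \<le> y \<Longrightarrow> is_interval {x..y}"
  by (auto simp: is_interval_def)

lemma is_interval_between:
  assumes "is_interval J" "x \<in> J" "z \<in> J" "x \<le> y" "y \<le> z"
  shows "y \<in> J"
  using assms by (auto simp: is_interval_def)

lemma is_interval_Un:
  assumes "is_interval I" "is_interval J" "I \<inter> J \<noteq> {}"
  shows "is_interval (I \<union> J)"
proof -
  obtain a b c d where "I = {a..b}" "J = {c..d}"
    using assms by (auto simp: is_interval_def)
  moreover from this assms(3) have "{a..b} \<union> {c..d} = {min a c..max b d}"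
    by auto
  ultimately show ?thesis
    using assms by (metis Un_empty is_interval_def)
qed

lemma components_D:
  assumes "J \<in> components X"
  shows "is_interval J" "J \<subseteq> X" "J \<noteq> {}"
  using assms by (auto simp: components_def is_interval_def)

lemma components_subset_Pow: "components X \<subseteq> Pow X"
  by (auto dest: components_D)

lemma finite_components: "finite X \<Longrightarrow> finite (components X)"
  by (rule finite_subset[OF components_subset_Pow]) simp

text \<open>Among the finitely many intervals inside \<open>X\<close> there is a maximal one above
  \<open>I\<close>, and maximal intervals are the components.\<close>

lemma interval_in_component:
  assumes "finite X" "is_interval I" "I \<subseteq> X"
  shows "\<exists>J\<in>components X. I \<subseteq> J"
proof -
  let ?F = "{J. is_interval J \<and> J \<subseteq> X}"
  have "finite ?F" using assms(1) by (rule finite_subset[rotated, OF finite_Pow_iff[THEN iffD2]]) auto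
  moreover have "I \<in> ?F" using assms by simp
  ultimately obtain J where "J \<in> ?F" "I \<subseteq> J" "\<forall>K\<in>?F. J \<subseteq> K \<longrightarrow> J = K"
    using finite_has_maximal2[of ?F I] by blast
  then show ?thesis by (auto simp: components_def)
qed

text \<open>Two intervals that meet have an interval as union, so by maximality both equal
  it.\<close>

lemma components_disjnt:
  assumes "J \<in> components X" "K \<in> components X" "x \<in> J" "x \<in> K"
  shows "J = K"
proof -
  have "is_interval (J \<union> K)" using assms by (intro is_interval_Un) (auto dest: components_D)
  moreover have "J \<union> K \<subseteq> X" using assms components_D by blast
  ultimately have "J \<union> K = J" "J \<union> K = K"
    using assms unfolding components_def by blast+
  then show ?thesis by simp
qed

lemma partition_on_components:
  assumes "finite X"
  shows "partition_on X (components X)"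
proof (rule partition_onI)
  have "\<exists>J\<in>components X. x \<in> J" if "x \<in> X" for x
    using interval_in_component[OF assms is_interval_Icc[of x x]] that by auto
  then show "\<Union> (components X) = X"
    using components_D by blast
  show "disjnt J K" if "J \<in> components X" "K \<in> components X" "J \<noteq> K" for J K
    using components_disjnt that by (auto simp: disjnt_def)
  show "{} \<notin> components X" using components_D(3) by blast
qed

text \<open>Sorted insertion by a key is well behaved on a set where the key is injective; that set
  is taken to be \<open>A\<close> itself.\<close>

lemma (in linorder)
  assumes "inj_on f A" "finite A"
  shows set_sorted_key_list_of_set_inj: "set (sorted_key_list_of_set f A) = A"
    and distinct_sorted_key_list_of_set_inj: "distinct (sorted_key_list_of_set f A)"
proof -
  interpret folding_insort_key less_eq less A f
    by unfold_locales fact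
  show "set (sorted_key_list_of_set f A) = A" "distinct (sorted_key_list_of_set f A)"
    using assms(2) distinct_sorted_key_list_of_set[of A] by (auto simp: distinct_map)
qed

text \<open>Components are disjoint, hence told apart by their minima. So sorting by
  \<open>Min\<close> neither drops nor repeats one.\<close>

lemma
  assumes "finite X"
  shows set_component_list: "set (component_list X) = components X"
    and distinct_component_list: "distinct (component_list X)"
proof -
  have "inj_on Min (components X)"
  proof (rule inj_onI)
    fix J K assume JK: "J \<in> components X" "K \<in> components X" "Min J = Min K"
    then have "finite J" "finite K" using assms components_D finite_subset by metis+
    with JK have "Min J \<in> J" "Min J \<in> K"
      using Min_in components_D(3) by metis+
    then show "J = K" using components_disjnt JK by blast
  qed
  then show "set (component_list X) = components X" "distinct (component_list X)"
    using finite_components[OF assms] unfolding component_list_def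
    by (rule set_sorted_key_list_of_set_inj distinct_sorted_key_list_of_set_inj)+
qed

lemma component_list_empty [simp]: "component_list {} = []"
proof -
  have "components {} = {}" using components_D(2,3)[of _ "{}"] by blast
  then show ?thesis using set_component_list[of "{}"] by simp
qed

lemma component_list_Icc:
  assumes "m \<le> n"
  shows "component_list {m..n} = [{m..n}]"
proof -
  have "components {m..n} = {{m..n}}"
    using assms is_interval_Icc[OF assms] by (auto simp: components_def)
  then have *: "set (component_list {m..n}) = {{m..n}}"
    by (simp add: set_component_list)
  then have "length (component_list {m..n}) = 1"
    using distinct_card[OF distinct_component_list[of "{m..n}"]] by simp
  with * show ?thesis by (auto simp: length_Suc_conv)
qed

section \<open>Subwords and the change of a single letter\<close>

lemma length_subword: "finite S \<Longrightarrow> length (subword a S) = card S"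
  by (simp add: subword_def)

lemma subword_all: "subword a {1..length a} = a"
proof -
  have "{1..length a} = {1..<Suc (length a)}" by auto
  then have "subword a {1..length a} = map (\<lambda>i. a ! (i - 1)) [1..<Suc (length a)]"
    by (simp only: subword_def sorted_list_of_set_range)
  also have "\<dots> = a" by (rule nth_equalityI) (simp_all del: upt_Suc)
  finally show ?thesis .
qed

lemma subword_update_notin:
  assumes "S \<subseteq> {1..length a}" "Suc i \<notin> S"
  shows "subword (a[i := z]) S = subword a S"
proof -
  have "finite S" using assms(1) finite_subset by blast
  moreover have "a[i := z] ! (j - 1) = a ! (j - 1)" if "j \<in> S" for j
  proof -
    have "j - 1 \<noteq> i" using that assms by (cases j) auto
    then show ?thesis by simp
  qed
  ultimately show ?thesis by (simp add: subword_def)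
qed

text \<open>Positions in \<open>S\<close> count from 1 and list indices from 0, whence
  \<open>Suc i\<close>. The index \<open>k\<close> is the place of \<open>Suc i\<close> in the
  sorted list of \<open>S\<close>; that it does not depend on \<open>z\<close> is what
  multilinearity requires.\<close>

lemma subword_update_in:
  assumes "S \<subseteq> {1..length a}" "Suc i \<in> S"
  shows "\<exists>k<card S. \<forall>z. subword (a[i := z]) S = (subword a S)[k := z]"
proof -
  have fin: "finite S" using assms(1) finite_subset by blast
  let ?xs = "sorted_list_of_set S"
  obtain k where k: "k < length ?xs" "?xs ! k = Suc i"
    using assms(2) fin by (metis in_set_conv_nth set_sorted_list_of_set)
  have "subword (a[i := z]) S = (subword a S)[k := z]" for z
  proof (rule nth_equalityI)
    show "length (subword (a[i := z]) S) = length ((subword a S)[k := z])"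
      by (simp add: subword_def)
    fix j assume "j < length (subword (a[i := z]) S)"
    then have j: "j < length ?xs" by (simp add: subword_def)
    then have "?xs ! j \<in> S" using nth_mem[OF j] by (simp only: set_sorted_list_of_set[OF fin])
    then have pos: "1 \<le> ?xs ! j" "?xs ! j \<le> length a" using assms(1) by auto
    have iff: "?xs ! j = Suc i \<longleftrightarrow> j = k"
      using nth_eq_iff_index_eq[OF _ j k(1)] k(2) by simp
    show "subword (a[i := z]) S ! j = (subword a S)[k := z] ! j"
    proof (cases "j = k")
      case True
      with pos iff j k show ?thesis by (simp add: subword_def)
    next
      case False
      with pos iff have "?xs ! j - 1 \<noteq> i" by (cases "?xs ! j") auto
      with False j show ?thesis by (simp add: subword_def)
    qed
  qed
  then show ?thesis using k fin by auto
qed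

section \<open>Multilinear functions\<close>

text \<open>A letter lies in exactly one block, so changing it affects one factor, which is
  multilinear, while all others stay constant.\<close>

lemma multilinear_prod_subwords:
  fixes scale :: "'k::field \<Rightarrow> 'a::ab_group_add \<Rightarrow> 'a"
  assumes part: "partition_on {1..n} P"
    and ml: "\<And>S. S \<in> P \<Longrightarrow> multilinear scale (card S) (G S)"
  shows "multilinear scale n (\<lambda>a. \<Prod>S\<in>P. G S (subword a S))"
  unfolding multilinear_def
proof (intro allI impI)
  fix a :: "'a list" and i x y c
  assume a: "length a = n" and "i < n"
  have finP: "finite P" using part finite_elements by blast
  have sub: "S \<subseteq> {1..length a}" if "S \<in> P" for S
    using that part a by (auto simp: partition_on_def)
  have "Suc i \<in> {1..n}" using \<open>i < n\<close> by simp
  then obtain T where T: "T \<in> P" "Suc i \<in> T"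
    using part unfolding partition_on_def by blast
  obtain k where k: "k < card T" "\<And>z. subword (a[i := z]) T = (subword a T)[k := z]"
    using subword_update_in[OF sub] T by blast
  have rest: "(\<Prod>S\<in>P - {T}. G S (subword (a[i := z]) S)) = (\<Prod>S\<in>P - {T}. G S (subword a S))" for z
  proof (rule prod.cong[OF refl])
    fix S assume S: "S \<in> P - {T}"
    then have "Suc i \<notin> S" using T part unfolding partition_on_def disjoint_def by blast
    then show "G S (subword (a[i := z]) S) = G S (subword a S)"
      using subword_update_notin[OF sub] S by simp
  qed
  have split: "(\<Prod>S\<in>P. G S (subword (a[i := z]) S)) =
      G T ((subword a T)[k := z]) * (\<Prod>S\<in>P - {T}. G S (subword a S))" for z
    using prod.remove[OF finP T(1), of "\<lambda>S. G S (subword (a[i := z]) S)"] by (simp add: k(2) rest)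
  have "finite T" using sub[OF T(1)] finite_subset by blast
  then have "length (subword a T) = card T" by (rule length_subword)
  then show "(\<Prod>S\<in>P. G S (subword (a[i := x + y]) S)) =
      (\<Prod>S\<in>P. G S (subword (a[i := x]) S)) + (\<Prod>S\<in>P. G S (subword (a[i := y]) S)) \<and>
      (\<Prod>S\<in>P. G S (subword (a[i := scale c x]) S)) = c * (\<Prod>S\<in>P. G S (subword (a[i := x]) S))"
    unfolding split using ml[OF T(1), unfolded multilinear_def, rule_format, of "subword a T" k x y c] k(1)
    by (simp add: algebra_simps)
qed

lemma multilinear_sum:
  "(\<And>i. i \<in> I \<Longrightarrow> multilinear scale n (F i)) \<Longrightarrow> multilinear scale n (\<lambda>a. \<Sum>i\<in>I. F i a)"
  unfolding multilinear_def by (simp add: sum.distrib sum_distrib_left)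

lemma multilinearD:
  assumes "multilinear scale n F" "length a = n" "i < n"
  shows "F (a[i := x + y]) = F (a[i := x]) + F (a[i := y])" "F (a[i := scale c x]) = c * F (a[i := x])"
  using assms unfolding multilinear_def by blast+

lemma multilinear_diff:
  "multilinear scale n F \<Longrightarrow> multilinear scale n G \<Longrightarrow> multilinear scale n (\<lambda>a. F a - G a)"
  by (subst multilinear_def) (simp add: multilinearD right_diff_distrib)

lemma multilinear_mult_const:
  assumes "multilinear scale n F"
  shows "multilinear scale n (\<lambda>a. c * F a * d)"
  by (subst multilinear_def) (simp add: multilinearD[OF assms] distrib_left distrib_right mult.left_commute mult.assoc)

lemma multilinear_cong:
  "(\<And>a. length a = n \<Longrightarrow> F a = G a) \<Longrightarrow> multilinear scale n F \<longleftrightarrow> multilinear scale n G"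
  unfolding multilinear_def by simp

section \<open>Non-crossing partitions\<close>

text \<open>Blocks keep their actual positions here; this allows cutting and gluing of partitions
  before anything is standardized.\<close>

definition NC_on :: "nat set \<Rightarrow> nat set set set" where
  "NC_on X = {P. partition_on X P \<and> noncrossing P}"

lemma NC_eq_NC_on: "NC n = NC_on {1..n}"
  by (simp add: NC_def NC_on_def)

lemma NC_on_D:
  assumes "P \<in> NC_on X"
  shows "partition_on X P" "noncrossing P" "\<Union>P = X"
  using assms by (auto simp: NC_on_def partition_on_def)

lemma finite_NC_on: "finite X \<Longrightarrow> finite (NC_on X)"
  by (rule finite_subset[of _ "Pow (Pow X)"]) (auto simp: NC_on_def partition_on_def)

lemma noncrossingD:
  assumes "noncrossing L" "B \<in> L" "C \<in> L" "B \<noteq> C" "p1 \<in> B" "q1 \<in> C" "p2 \<in> B" "q2 \<in> C"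
    "p1 < q1" "q1 < p2" "p2 < q2"
  shows False
  using assms(1)[unfolded noncrossing_def] by (rule notE) (intro bexI conjI; fact)

lemma noncrossingI:
  assumes "\<And>B C p1 q1 p2 q2. B \<in> L \<Longrightarrow> C \<in> L \<Longrightarrow> B \<noteq> C \<Longrightarrow> p1 \<in> B \<Longrightarrow> q1 \<in> C \<Longrightarrow> p2 \<in> B \<Longrightarrow>
    q2 \<in> C \<Longrightarrow> p1 < q1 \<Longrightarrow> q1 < p2 \<Longrightarrow> p2 < q2 \<Longrightarrow> False"
  shows "noncrossing L"
  unfolding noncrossing_def by (intro notI; elim bexE conjE) (rule assms)

lemma noncrossing_subset:
  assumes "noncrossing L" "Q \<subseteq> L"
  shows "noncrossing Q"
proof (rule noncrossingI)
  fix B C p1 q1 p2 q2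
  assume BC: "B \<in> Q" "C \<in> Q" and rest: "B \<noteq> C" "p1 \<in> B" "q1 \<in> C" "p2 \<in> B" "q2 \<in> C"
    "p1 < q1" "q1 < p2" "p2 < q2"
  have "B \<in> L" "C \<in> L" using BC assms(2) by auto
  from noncrossingD[OF assms(1) this rest] show False .
qed

text \<open>A strictly increasing map reflects the order, so a crossing of image blocks pulls back
  to a crossing of the original ones.\<close>

lemma NC_on_image:
  assumes "strict_mono_on X f" "P \<in> NC_on X"
  shows "(`) f ` P \<in> NC_on (f ` X)"
proof -
  note P = NC_on_D[OF assms(2)]
  have inj: "inj_on f X" using assms(1) by (rule strict_mono_on_imp_inj_on)
  have "{} \<notin> (`) f ` P" using P(1) by (auto simp: partition_on_def)
  then have "partition_on (f ` X) ((`) f ` P)"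
    using partition_on_inj_image[OF P(1) inj] by simp
  moreover have less: "f x < f y \<longleftrightarrow> x < y" if "x \<in> X" "y \<in> X" for x y
    using assms(1) that by (metis strict_mono_on_less)
  have "noncrossing ((`) f ` P)"
  proof (rule noncrossingI)
    fix B' C' p1' q1' p2' q2'
    assume "B' \<in> (`) f ` P" "C' \<in> (`) f ` P" and neq: "B' \<noteq> C'"
      and elems: "p1' \<in> B'" "q1' \<in> C'" "p2' \<in> B'" "q2' \<in> C'" "p1' < q1'" "q1' < p2'" "p2' < q2'"
    then obtain B C where BC: "B \<in> P" "C \<in> P" "B' = f ` B" "C' = f ` C" by blast
    with elems obtain p1 q1 p2 q2 where pq: "p1 \<in> B" "q1 \<in> C" "p2 \<in> B" "q2 \<in> C"
      "f p1 < f q1" "f q1 < f p2" "f p2 < f q2" by auto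
    moreover have "B \<subseteq> X" "C \<subseteq> X" using BC P(3) by auto
    ultimately have "p1 < q1" "q1 < p2" "p2 < q2" by (auto simp: less subset_iff)
    moreover have "B \<noteq> C" using BC neq by auto
    ultimately show False using noncrossingD[OF P(2) BC(1,2)] pq by metis
  qed
  ultimately show ?thesis by (simp add: NC_on_def)
qed

lemma bij_betw_NC_on_image:
  assumes "strict_mono_on X f"
  shows "bij_betw ((`) ((`) f)) (NC_on X) (NC_on (f ` X))"
proof -
  have inj: "inj_on f X" using assms by (rule strict_mono_on_imp_inj_on)
  let ?g = "inv_into X f"
  have g: "strict_mono_on (f ` X) ?g"
  proof (rule strict_mono_onI)
    fix r s assume "r \<in> f ` X" "s \<in> f ` X" "r < s"
    then obtain x y where "x \<in> X" "y \<in> X" "r = f x" "s = f y" "f x < f y" by blast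
    then show "?g r < ?g s"
      using inj strict_mono_on_less[OF assms, of x y] by simp
  qed
  have "(`) ?g ` (`) f ` P = P" if "P \<in> NC_on X" for P
  proof -
    have "?g ` f ` B = B" if "B \<in> P" for B
      using that NC_on_D(3)[OF \<open>P \<in> NC_on X\<close>] inj by (intro inv_into_image_cancel) auto
    then show ?thesis by (simp add: image_image)
  qed
  moreover have "(`) f ` (`) ?g ` P = P" if "P \<in> NC_on (f ` X)" for P
  proof -
    have "f ` ?g ` B = B" if "B \<in> P" for B
      using that NC_on_D(3)[OF \<open>P \<in> NC_on (f ` X)\<close>] by (intro image_inv_into_cancel) auto
    then show ?thesis by (simp add: image_image)
  qed
  moreover have "?g ` f ` X = X" using inj by (intro inv_into_image_cancel) auto
  moreover have "(`) ((`) f) \<in> NC_on X \<rightarrow> NC_on (f ` X)"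
    using NC_on_image[OF assms] by blast
  moreover have "(`) ((`) ?g) \<in> NC_on (f ` X) \<rightarrow> NC_on (?g ` f ` X)"
    using NC_on_image[OF g] by blast
  ultimately show ?thesis
    by (intro bij_betwI[of _ _ _ "(`) ((`) ?g)"]) simp_all
qed

section \<open>Ranks and standardization\<close>

lemma strict_mono_on_rank:
  assumes "finite (X :: nat set)"
  shows "strict_mono_on X (\<lambda>x. card {y \<in> X. y \<le> x})"
proof (rule strict_mono_onI)
  fix r s assume "r \<in> X" "s \<in> X" "r < s"
  then have "{y \<in> X. y \<le> r} \<subseteq> {y \<in> X. y \<le> s}" "s \<in> {y \<in> X. y \<le> s} - {y \<in> X. y \<le> r}" by auto
  then have "{y \<in> X. y \<le> r} \<subset> {y \<in> X. y \<le> s}" by blast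
  then show "card {y \<in> X. y \<le> r} < card {y \<in> X. y \<le> s}"
    using assms by (intro psubset_card_mono) auto
qed

lemma rank_image:
  assumes "finite (X :: nat set)"
  shows "(\<lambda>x. card {y \<in> X. y \<le> x}) ` X = {1..card X}" (is "?f ` X = _")
proof (rule card_subset_eq)
  show "?f ` X \<subseteq> {1..card X}"
  proof
    fix k assume "k \<in> ?f ` X"
    then obtain x where x: "x \<in> X" "k = ?f x" by blast
    then have "k > 0" using assms by (auto simp: card_gt_0_iff)
    moreover have "k \<le> card X" using x assms by (auto intro: card_mono)
    ultimately show "k \<in> {1..card X}" by simp
  qed
  show "card (?f ` X) = card {1..card X}"
    using card_image[OF strict_mono_on_imp_inj_on[OF strict_mono_on_rank[OF assms]]] by simp
qed simp

text \<open>All partitions of \<open>X\<close> have the same union, so \<open>standardize\<close>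
  transports them along one and the same rank map, which is strictly increasing from
  \<open>X\<close> onto an initial segment.\<close>

lemma bij_betw_standardize:
  assumes "finite X"
  shows "bij_betw standardize (NC_on X) (NC (card X))"
proof -
  have "bij_betw ((`) ((`) (\<lambda>x. card {y \<in> X. y \<le> x}))) (NC_on X) (NC (card X))"
    using bij_betw_NC_on_image[OF strict_mono_on_rank[OF assms]]
    by (simp add: rank_image[OF assms] NC_eq_NC_on)
  moreover have "standardize P = (`) ((`) (\<lambda>x. card {y \<in> X. y \<le> x})) P" if "P \<in> NC_on X" for P
    using NC_on_D(3)[OF that] by (simp add: standardize_def)
  ultimately show ?thesis using bij_betw_cong by (metis (no_types, lifting))
qed

lemma standardize_in_NC: "finite X \<Longrightarrow> P \<in> NC_on X \<Longrightarrow> standardize P \<in> NC (card X)"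
  using bij_betw_standardize bij_betwE by blast

lemma standardize_NC:
  assumes "L \<in> NC n"
  shows "standardize L = L"
proof -
  have L: "\<Union>L = {1..n}" using assms NC_on_D by (simp add: NC_eq_NC_on)
  have rank: "card {y \<in> \<Union>L. y \<le> x} = x" if "x \<in> {1..n}" for x
  proof -
    have "{y \<in> \<Union>L. y \<le> x} = {1..x}" using that L by auto
    then show ?thesis by simp
  qed
  have "(\<lambda>x. card {y \<in> \<Union>L. y \<le> x}) ` B = B" if "B \<in> L" for B
  proof -
    have "B \<subseteq> {1..n}" using that L by auto
    then have "(\<lambda>x. card {y \<in> \<Union>L. y \<le> x}) ` B = (\<lambda>x. x) ` B"
      by (intro image_cong refl rank) auto
    then show ?thesis by simp
  qed
  then show ?thesis by (simp add: standardize_def)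
qed

section \<open>Admissible decompositions\<close>

lemma admissible_NC_on:
  assumes "L \<in> NC n" "admissible L Q"
  shows "Q \<in> NC_on (\<Union>Q)" "\<Union>Q \<subseteq> {1..n}"
proof -
  have "Q \<subseteq> L" using assms(2) by (simp add: admissible_def)
 have "partition_on {1..n} L" and nc: "noncrossing L" using assms(1) by (auto simp: NC_def)
  have "noncrossing Q" using nc \<open>Q \<subseteq> L\<close> by (rule noncrossing_subset)
  moreover have "partition_on (\<Union>Q) Q"
    using \<open>partition_on {1..n} L\<close> \<open>Q \<subseteq> L\<close> by (intro partition_onI) (auto simp: partition_on_def pairwise_def subset_iff)
  ultimately show "Q \<in> NC_on (\<Union>Q)" by (simp add: NC_on_def)
  show "\<Union>Q \<subseteq> {1..n}" using \<open>Q \<subseteq> L\<close> \<open>partition_on {1..n} L\<close> unfolding partition_on_def by blast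
qed

text \<open>The convex hull of a block \<open>C\<close> outside \<open>Q\<close> contains no point
  of a block of \<open>Q\<close>: such a point would force either a nesting that admissibility
  forbids or a crossing. The hull is thus an interval of the complement and lies in one
  component.\<close>

lemma block_in_component:
  assumes "L \<in> NC n" "admissible L Q" "C \<in> L - Q"
  shows "\<exists>J\<in>components ({1..n} - \<Union>Q). C \<subseteq> J"
proof -
  have part: "partition_on {1..n} L" and nc: "noncrossing L" using assms(1) by (auto simp: NC_def)
  have C: "C \<subseteq> {1..n}" "C \<noteq> {}" using part assms(3) by (auto simp: partition_on_def)
  then have fin: "finite C" using finite_subset by blast
  let ?I = "{Min C..Max C}"
  have mM: "Min C \<in> C" "Max C \<in> C" using fin C by auto
  have "?I \<subseteq> {1..n} - \<Union>Q"
  proof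
    fix c assume c: "c \<in> ?I"
    have "c \<in> {1..n}" using c mM C(1) by auto
    moreover have "c \<notin> B" if B: "B \<in> Q" for B
    proof
      assume "c \<in> B"
      have BL: "B \<in> L" "B \<noteq> C" using B assms(2,3) by (auto simp: admissible_def)
      then have disj: "B \<inter> C = {}" using part assms(3) by (auto simp: partition_on_def disjoint_def)
      then have "Min C < c" "c < Max C"
        using c mM \<open>c \<in> B\<close> by (auto simp: le_less)
      moreover have "\<not> nested_in B C" using assms(2,3) B by (auto simp: admissible_def)
      then obtain m where m: "m \<in> B" "m \<le> Min C \<or> Max C \<le> m" by (auto simp: nested_in_def not_less)
      then have "m < Min C \<or> Max C < m" using disj mM by (auto simp: le_less)
      \<comment> \<open>The point \<open>m\<close> of \<open>B\<close> lies left or right of the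
        hull of \<open>C\<close>. The crossing is \<open>m < Min C < c < Max C\<close> in the first
        case and \<open>Min C < c < Max C < m\<close> in the second.\<close>
      ultimately show False
        using noncrossingD[OF nc BL(1) _ BL(2), of m "Min C" c "Max C"]
          noncrossingD[OF nc _ BL(1) BL(2)[symmetric], of "Min C" c "Max C" m]
          m(1) mM assms(3) \<open>c \<in> B\<close> by blast
    qed
    ultimately show "c \<in> {1..n} - \<Union>Q" by blast
  qed
  moreover have "is_interval ?I" using mM fin by (intro is_interval_Icc) auto
  ultimately obtain J where "J \<in> components ({1..n} - \<Union>Q)" "?I \<subseteq> J"
    using interval_in_component by (metis finite_Diff finite_atLeastAtMost)
  moreover have "C \<subseteq> ?I" using fin by auto
  ultimately show ?thesis by blast
qed

text \<open>Every block outside \<open>Q\<close> stays inside one component, so the blocks contained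
  in \<open>J\<close> already cover \<open>J\<close>.\<close>

lemma restrict_in_NC_on:
  assumes "L \<in> NC n" "admissible L Q" "J \<in> components ({1..n} - \<Union>Q)"
  shows "{B \<in> L - Q. B \<subseteq> J} \<in> NC_on J"
proof -
  have part: "partition_on {1..n} L" and nc: "noncrossing L" using assms(1) by (auto simp: NC_def)
  have "x \<in> \<Union>{B \<in> L - Q. B \<subseteq> J}" if x: "x \<in> J" for x
  proof -
    have "x \<in> {1..n} - \<Union>Q" using x components_D(2)[OF assms(3)] by auto
    then obtain C where C: "C \<in> L - Q" "x \<in> C" using part unfolding partition_on_def by blast
    then obtain K where K: "K \<in> components ({1..n} - \<Union>Q)" "C \<subseteq> K"
      using block_in_component[OF assms(1,2)] by blast
    then have "K = J" using components_disjnt assms(3) x C by blast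
    then show ?thesis using C K by auto
  qed
  then have "\<Union>{B \<in> L - Q. B \<subseteq> J} = J" by blast
  moreover have "noncrossing {B \<in> L - Q. B \<subseteq> J}" using nc by (rule noncrossing_subset) auto
  ultimately show ?thesis
    using part by (auto simp: NC_on_def partition_on_def disjoint_def)
qed

text \<open>Converse to the two preceding lemmas: a partition of \<open>S\<close> and independent
  partitions of the components fit together to an admissible decomposition. The reason throughout is
  that components are intervals disjoint from \<open>S\<close>.\<close>

lemma admissible_glue:
  assumes S: "S \<subseteq> {1..n}" and Q: "Q \<in> NC_on S"
    and P: "\<And>J. J \<in> components ({1..n} - S) \<Longrightarrow> P J \<in> NC_on J"
  defines "L \<equiv> Q \<union> (\<Union>J\<in>components ({1..n} - S). P J)"
  shows "L \<in> NC n" "admissible L Q"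
    "\<And>J. J \<in> components ({1..n} - S) \<Longrightarrow> {B \<in> L - Q. B \<subseteq> J} = P J"
proof -
  let ?K = "components ({1..n} - S)"
  have UQ: "\<Union>Q = S" and Qp: "{} \<notin> Q" "\<And>B C. B \<in> Q \<Longrightarrow> C \<in> Q \<Longrightarrow> B \<noteq> C \<Longrightarrow> B \<inter> C = {}"
    using NC_on_D[OF Q] by (auto simp: partition_on_def disjoint_def)
  have UP: "\<Union>(P J) = J" "{} \<notin> P J" "\<And>B C. B \<in> P J \<Longrightarrow> C \<in> P J \<Longrightarrow> B \<noteq> C \<Longrightarrow> B \<inter> C = {}" if "J \<in> ?K" for J
    using NC_on_D[OF P[OF that]] by (auto simp: partition_on_def disjoint_def)
  have UK: "\<Union>?K = {1..n} - S" using partition_on_components[of "{1..n} - S"] by (simp add: partition_on_def)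
  have disjK: "B \<inter> J = {}" if "J \<in> ?K" "B \<in> L" "B \<notin> P J" for B J
  proof (cases "B \<in> Q")
    case True
    then show ?thesis using UQ components_D(2)[OF that(1)] by blast
  next
    case False
    with \<open>B \<in> L\<close> obtain K where K: "K \<in> ?K" "B \<in> P K" by (auto simp: L_def)
    then have "K \<noteq> J" using that by auto
    then show ?thesis using components_disjnt[of K _ J] K that(1) UP(1)[OF K(1)] by blast
  qed
  have blocks: "B \<in> Q \<or> (\<exists>J\<in>?K. B \<in> P J)" if "B \<in> L" for B using that by (auto simp: L_def)
  have sub: "B \<subseteq> J" if "J \<in> ?K" "B \<in> P J" for B J using UP(1) that by blast
  have "{} \<notin> L" using Qp(1) UP(2) by (auto simp: L_def)
  have "partition_on {1..n} L"
  proof (rule partition_onI)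
    have "\<Union>L = S \<union> (\<Union>J\<in>?K. \<Union>(P J))" using UQ by (auto simp: L_def)
    also have "\<dots> = S \<union> \<Union>?K" using UP(1) by simp
    finally show "\<Union>L = {1..n}" using UK S by auto
    show "{} \<notin> L" by fact
    fix B C assume BC: "B \<in> L" "C \<in> L" "B \<noteq> C"
    show "disjnt B C"
    proof (cases "B \<in> Q \<and> C \<in> Q")
      case True
      then show ?thesis using Qp(2) BC by (simp add: disjnt_def)
    next
      case False
      moreover have "disjnt B C" if "J \<in> ?K" "C \<in> P J" "B \<in> L" "B \<noteq> C" for B C J
      proof (cases "B \<in> P J")
        case True
        then show ?thesis using UP(3)[OF that(1)] that by (simp add: disjnt_def)
      next
        case False
        then show ?thesis using disjK[OF that(1,3)] sub[OF that(1,2)] by (auto simp: disjnt_def)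
      qed
      ultimately show ?thesis using BC blocks[of B] blocks[of C] by (metis disjnt_sym)
    qed
  qed
  moreover have "noncrossing L"
  proof (rule noncrossingI)
    fix B C p1 q1 p2 q2
    assume BC: "B \<in> L" "C \<in> L" "B \<noteq> C" "p1 \<in> B" "q1 \<in> C" "p2 \<in> B" "q2 \<in> C" "p1 < q1" "q1 < p2" "p2 < q2"
    show False
    proof (cases "\<exists>J\<in>?K. C \<in> P J")
      case True
      then obtain J where J: "J \<in> ?K" "C \<in> P J" by blast
      \<comment> \<open>The point \<open>p2\<close> is caught between two points of the interval
        \<open>J\<close>, so the crossing would take place inside \<open>P J\<close>.\<close>
      then have "p2 \<in> J"
        using BC sub[OF J] by (intro is_interval_between[of J q1 q2 p2]) (auto dest: components_D)
      then have "B \<in> P J" using disjK[OF J(1)] BC by blast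
      then show False using noncrossingD[OF NC_on_D(2)[OF P[OF J(1)]] _ J(2) BC(3-10)] by blast
    next
      case False
      then have CQ: "C \<in> Q" using blocks BC by blast
      show False
      proof (cases "B \<in> Q")
        case True
        then show False using noncrossingD[OF NC_on_D(2)[OF Q] _ CQ BC(3-10)] by blast
      next
        case False
        then obtain J where J: "J \<in> ?K" "B \<in> P J" using blocks BC by blast
        \<comment> \<open>Now \<open>B\<close> lies in a component and \<open>C\<close> in
          \<open>S\<close>; the point \<open>q1\<close> between \<open>p1\<close> and
          \<open>p2\<close> would belong to both.\<close>
        then have "q1 \<in> J"
          using BC sub[OF J] by (intro is_interval_between[of J p1 p2 q1]) (auto dest: components_D)
        then show False using CQ UQ BC components_D(2)[OF J(1)] by blast
      qed
    qed
  qed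
  ultimately show "L \<in> NC n" by (simp add: NC_def)
  have PQ: "B \<notin> Q" if "J \<in> ?K" "B \<in> P J" for B J
  proof
    assume "B \<in> Q"
    then have "B \<subseteq> S" using UQ by auto
    moreover have "B \<subseteq> {1..n} - S" using sub[OF that] components_D(2)[OF that(1)] by blast
    ultimately have "B = {}" by blast
    then show False using UP(2) that by blast
  qed
  show "admissible L Q"
    unfolding admissible_def
  proof (intro conjI notI)
    show "Q \<subseteq> L" by (simp add: L_def)
    assume "\<exists>B\<in>Q. \<exists>C\<in>L - Q. nested_in B C"
    then obtain B C where BC: "B \<in> Q" "C \<in> L - Q" "nested_in B C" by blast
    then obtain J where J: "J \<in> ?K" "C \<in> P J" using blocks by blast
    obtain m where m: "m \<in> B" using BC(1) Qp(1) by fastforce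
    have "C \<noteq> {}" using J UP(2) by auto
    moreover have "finite C"
      using sub[OF J] components_D(2)[OF J(1)] by (meson finite_Diff finite_atLeastAtMost finite_subset)
    ultimately have "Min C \<in> J" "Max C \<in> J" using sub[OF J] Min_in[of C] Max_in[of C] by blast+
    \<comment> \<open>A block nested in \<open>C\<close> would have its points in the interval
      \<open>J\<close>, although the blocks of \<open>Q\<close> cover only \<open>S\<close>.\<close>
    then have "m \<in> J"
      using BC(3) m components_D(1)[OF J(1)]
      by (intro is_interval_between[of J "Min C" "Max C" m]) (auto simp: nested_in_def less_imp_le)
    then show False using m BC(1) UQ components_D(2)[OF J(1)] by blast
  qed
  show "{B \<in> L - Q. B \<subseteq> J} = P J" if J: "J \<in> ?K" for J
  proof
    show "P J \<subseteq> {B \<in> L - Q. B \<subseteq> J}" using sub[OF J] PQ[OF J] J by (auto simp: L_def)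
    show "{B \<in> L - Q. B \<subseteq> J} \<subseteq> P J"
    proof
      fix B assume B: "B \<in> {B \<in> L - Q. B \<subseteq> J}"
      then have "B \<noteq> {}" using \<open>{} \<notin> L\<close> by auto
      then show "B \<in> P J" using disjK[OF J, of B] B by blast
    qed
  qed
qed

section \<open>The coproducts as sums over proper terms\<close>

lemma nc_Word_cases:
  obtains L a where "w = NC_Word (L, a)" "a \<noteq> []" "L \<in> NC (length a)"
proof -
  obtain L a where La: "nc_data w = (L, a)" by (cases "nc_data w")
  then have "w = NC_Word (L, a)" using nc_data_inverse[of w] by simp
  then show ?thesis using that nc_data[of w] La by simp
qed

lemma
  assumes "a \<noteq> []" "L \<in> NC (length a)"
  shows nc_partition_NC_Word [simp]: "nc_partition (NC_Word (L, a)) = L"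
    and nc_letters_NC_Word [simp]: "nc_letters (NC_Word (L, a)) = a"
  using assms by (simp_all add: nc_partition_def nc_letters_def NC_Word_inverse)

lemma nc_partition_NC: "nc_partition w \<in> NC (length (nc_letters w))"
  by (cases w rule: nc_Word_cases) simp

lemma nc_letters_nonempty: "nc_letters w \<noteq> []"
  by (cases w rule: nc_Word_cases) simp

lemma NC_Word_collapse: "NC_Word (nc_partition w, nc_letters w) = w"
  by (cases w rule: nc_Word_cases) simp

definition nc_deg :: "'a nc_word \<Rightarrow> nat" where
  "nc_deg w = length (nc_letters w)"

definition nc_idx :: "'a nc_word \<Rightarrow> nat set set set" where
  "nc_idx w = {Q. admissible (nc_partition w) Q \<and> Q \<noteq> {}}"

definition nc_idxl :: "'a nc_word \<Rightarrow> nat set set set" where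
  "nc_idxl w = {Q. admissible (nc_partition w) Q \<and> (\<exists>B\<in>Q. 1 \<in> B)}"

definition nc_lft :: "'a nc_word \<Rightarrow> nat set set \<Rightarrow> 'a nc_word" where
  "nc_lft w Q = NC_Word (standardize Q, subword (nc_letters w) (\<Union>Q))"

definition nc_piece :: "'a nc_word \<Rightarrow> nat set set \<Rightarrow> nat set \<Rightarrow> 'a nc_word" where
  "nc_piece w Q J = NC_Word (standardize {B \<in> nc_partition w - Q. B \<subseteq> J}, subword (nc_letters w) J)"

definition nc_rgt :: "'a nc_word \<Rightarrow> nat set set \<Rightarrow> 'a nc_word list" where
  "nc_rgt w Q = map (nc_piece w Q) (component_list ({1..nc_deg w} - \<Union>Q))"

lemma nc_deg_NC_Word: "a \<noteq> [] \<Longrightarrow> L \<in> NC (length a) \<Longrightarrow> nc_deg (NC_Word (L, a)) = length a"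
  by (simp add: nc_deg_def)

lemma nc_idxl_subset: "nc_idxl w \<subseteq> nc_idx w"
  by (auto simp: nc_idxl_def nc_idx_def)

lemma admissible_empty [simp]: "admissible L {}"
  by (simp add: admissible_def)

lemma admissible_self [simp]: "admissible L L"
  by (simp add: admissible_def)

lemma finite_NC_member: "L \<in> NC n \<Longrightarrow> finite L"
  using finite_elements[of "{1..n}" L] by (simp add: NC_def)

lemma finite_admissible: "finite L \<Longrightarrow> finite {Q. admissible L Q}"
  by (rule finite_subset[of _ "Pow L"]) (auto simp: admissible_def)

lemma Union_nc_idx:
  assumes "Q \<in> nc_idx w"
  shows "Q \<in> NC_on (\<Union>Q)" "\<Union>Q \<subseteq> {1..nc_deg w}" "\<Union>Q \<noteq> {}" "finite (\<Union>Q)"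
proof -
  have adm: "admissible (nc_partition w) Q" and "Q \<noteq> {}" using assms by (auto simp: nc_idx_def)
  note * = admissible_NC_on[OF nc_partition_NC adm]
  show "Q \<in> NC_on (\<Union>Q)" by (rule *(1))
  show sub: "\<Union>Q \<subseteq> {1..nc_deg w}" using *(2) by (simp add: nc_deg_def)
  show "\<Union>Q \<noteq> {}" using NC_on_D(1)[OF *(1)] \<open>Q \<noteq> {}\<close> by (auto simp: partition_on_def)
  show "finite (\<Union>Q)" using sub finite_subset by blast
qed

text \<open>Standardization makes the partition match the length of the subword, so the pair lies in
  the range on which \<open>NC_Word\<close> is injective and its data can be read back.\<close>

lemma NC_Word_subword:
  assumes "finite X" "X \<noteq> {}" "P \<in> NC_on X"
  shows "nc_deg (NC_Word (standardize P, subword a X)) = card X"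
proof -
  have "length (subword a X) = card X" using assms(1) by (rule length_subword)
  moreover have "card X \<noteq> 0" using assms by simp
  ultimately show ?thesis
    using standardize_in_NC[OF assms(1,3)] by (subst nc_deg_NC_Word) (auto simp del: card_eq_0_iff)
qed

lemma nc_deg_lft: "Q \<in> nc_idx w \<Longrightarrow> nc_deg (nc_lft w Q) = card (\<Union>Q)"
  unfolding nc_lft_def by (intro NC_Word_subword Union_nc_idx)

lemma nc_deg_piece:
  assumes "admissible (nc_partition w) Q" "J \<in> components ({1..nc_deg w} - \<Union>Q)"
  shows "nc_deg (nc_piece w Q J) = card J"
proof -
  have "finite J" using components_D(2)[OF assms(2)] by (rule finite_subset) simp
  then show ?thesis
    unfolding nc_piece_def using assms
    by (intro NC_Word_subword restrict_in_NC_on[OF nc_partition_NC])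
      (auto simp: nc_deg_def dest: components_D)
qed

lemma sum_card_components: "finite X \<Longrightarrow> (\<Sum>J\<in>components X. card J) = card X"
  using partition_on_components[of X] card_Union_disjoint[of "components X"]
  by (metis finite_UnionD finite_elements finite_subset partition_on_def components_D(2))

lemma sum_list_component_list:
  fixes f :: "nat set \<Rightarrow> nat"
  shows "finite X \<Longrightarrow> sum_list (map f (component_list X)) = (\<Sum>J\<in>components X. f J)"
  using sum.distinct_set_conv_list[OF distinct_component_list[of X], of f] by (simp add: set_component_list)

lemma prod_list_component_list:
  fixes f :: "nat set \<Rightarrow> 'k::comm_monoid_mult"
  shows "finite X \<Longrightarrow> prod_list (map f (component_list X)) = (\<Prod>J\<in>components X. f J)"
  using prod.distinct_set_conv_list[OF distinct_component_list[of X], of f] by (simp add: set_component_list)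

text \<open>The pieces on the right carry exactly the letters outside \<open>\<Union>Q\<close>, and
  \<open>\<Union>Q\<close> is nonempty.\<close>

lemma nc_deg_rgt:
  assumes "Q \<in> nc_idx w"
  shows "sum_list (map nc_deg (nc_rgt w Q)) < nc_deg w"
proof -
  let ?X = "{1..nc_deg w} - \<Union>Q"
  have adm: "admissible (nc_partition w) Q" using assms by (simp add: nc_idx_def)
  have "sum_list (map nc_deg (nc_rgt w Q)) = (\<Sum>J\<in>components ?X. nc_deg (nc_piece w Q J))"
    using sum_list_component_list[of ?X "\<lambda>J. nc_deg (nc_piece w Q J)"] by (simp add: nc_rgt_def o_def)
  also have "\<dots> = card ?X"
    using nc_deg_piece[OF adm] sum_card_components[of ?X] by simp
  also have "\<dots> < card {1..nc_deg w}"
    using Union_nc_idx[OF assms] by (intro psubset_card_mono) auto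
  finally show ?thesis by simp
qed

text \<open>With nothing cut off, the complement is the whole of [n], a single component, and
  standardization does nothing.\<close>

lemma nc_term_empty: "nc_term w {} = ([], [w])"
proof -
  let ?n = "length (nc_letters w)"
  have "1 \<le> ?n" using nc_letters_nonempty[of w] by (cases "nc_letters w") auto
  moreover have "{B \<in> nc_partition w. B \<subseteq> {1..?n}} = nc_partition w"
    using NC_on_D(3)[of "nc_partition w" "{1..?n}"] nc_partition_NC[of w] by (auto simp: NC_eq_NC_on)
  ultimately show ?thesis
    using component_list_Icc[of 1 ?n]
    by (simp add: nc_term_def standardize_NC[OF nc_partition_NC] subword_all[simplified] NC_Word_collapse)
qed

lemma nc_term_nonempty: "Q \<noteq> {} \<Longrightarrow> nc_term w Q = ([nc_lft w Q], nc_rgt w Q)"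
  by (simp add: nc_term_def nc_lft_def nc_rgt_def nc_piece_def[abs_def] nc_deg_def)

interpretation nc: half_shuffle nc_coprod nc_coprod_left nc_idx nc_idxl nc_lft nc_rgt nc_deg
proof
  fix w :: "'a nc_word" and Q
  have adm: "{Q. admissible (nc_partition w) Q} = insert {} (nc_idx w)"
    by (auto simp: nc_idx_def)
  have fin: "finite (nc_idx w)"
    using finite_admissible[OF finite_NC_member[OF nc_partition_NC, of w]] unfolding adm by simp
  have "nc_coprod w = basis_vec (nc_term w {}) + (\<Sum>Q\<in>nc_idx w. basis_vec (nc_term w Q))"
    unfolding nc_coprod_def adm using fin by (subst sum.insert) (auto simp: nc_idx_def)
  also have "(\<Sum>Q\<in>nc_idx w. basis_vec (nc_term w Q)) = (\<Sum>q\<in>nc_idx w. basis_vec ([nc_lft w q], nc_rgt w q))"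
    by (intro sum.cong refl) (simp add: nc_term_nonempty nc_idx_def)
  finally show "nc_coprod w = basis_vec ([], [w]) + (\<Sum>q\<in>nc_idx w. basis_vec ([nc_lft w q], nc_rgt w q))"
    by (simp add: nc_term_empty)
  show "nc_coprod_left w = (\<Sum>q\<in>nc_idxl w. basis_vec ([nc_lft w q], nc_rgt w q))"
    unfolding nc_coprod_left_def nc_idxl_def[symmetric]
    by (intro sum.cong refl) (subst nc_term_nonempty, auto simp: nc_idxl_def)
  show "sum_list (map nc_deg (nc_rgt w Q)) < nc_deg w" if "Q \<in> nc_idxl w"
    using that nc_idxl_subset by (intro nc_deg_rgt) blast
qed

section \<open>Proper terms for words\<close>

definition word_deg :: "'a word \<Rightarrow> nat" where
  "word_deg w = length (letters w)"

definition word_idx :: "'a word \<Rightarrow> nat set set" where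
  "word_idx w = {S. S \<subseteq> {1..word_deg w} \<and> S \<noteq> {}}"

definition word_idxl :: "'a word \<Rightarrow> nat set set" where
  "word_idxl w = {S. S \<subseteq> {1..word_deg w} \<and> 1 \<in> S}"

definition word_part :: "'a word \<Rightarrow> nat set \<Rightarrow> 'a word" where
  "word_part w S = Word (subword (letters w) S)"

definition word_rgt :: "'a word \<Rightarrow> nat set \<Rightarrow> 'a word list" where
  "word_rgt w S = map (word_part w) (component_list ({1..word_deg w} - S))"

lemma letters_nonempty: "letters w \<noteq> []"
  using letters[of w] by simp

lemma letters_word_part:
  assumes "finite S" "S \<noteq> {}"
  shows "letters (word_part w S) = subword (letters w) S"
proof -
  have "length (subword (letters w) S) \<noteq> 0" using assms by (simp add: length_subword)
  then show ?thesis by (simp add: word_part_def Word_inverse)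
qed

lemma word_deg_part: "finite S \<Longrightarrow> S \<noteq> {} \<Longrightarrow> word_deg (word_part w S) = card S"
  by (simp add: word_deg_def letters_word_part length_subword)

lemma word_deg_rgt:
  assumes "S \<in> word_idx w"
  shows "sum_list (map word_deg (word_rgt w S)) < word_deg w"
proof -
  let ?X = "{1..word_deg w} - S"
  have "word_deg (word_part w J) = card J" if "J \<in> components ?X" for J
    using components_D[OF that] by (intro word_deg_part) (auto intro: finite_subset)
  then have "sum_list (map word_deg (word_rgt w S)) = card ?X"
    using sum_list_component_list[of ?X "\<lambda>J. word_deg (word_part w J)"] sum_card_components[of ?X]
    by (simp add: word_rgt_def o_def)
  also have "\<dots> < card {1..word_deg w}"
    using assms by (intro psubset_card_mono) (auto simp: word_idx_def)
  finally show ?thesis by simp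
qed

lemma word_term_empty: "word_term w {} = ([], [w])"
proof -
  have "1 \<le> length (letters w)" using letters_nonempty[of w] by (cases "letters w") auto
  then show ?thesis
    using component_list_Icc[of 1 "length (letters w)"]
    by (simp add: word_term_def subword_all[simplified] letters_inverse)
qed

lemma word_term_nonempty: "S \<noteq> {} \<Longrightarrow> word_term w S = ([word_part w S], word_rgt w S)"
  by (simp add: word_term_def word_part_def[abs_def] word_rgt_def word_deg_def)

interpretation wd: half_shuffle word_coprod word_coprod_left word_idx word_idxl word_part word_rgt word_deg
proof
  fix w :: "'a word" and S
  have Pow: "Pow {1..length (letters w)} = insert {} (word_idx w)"
    by (auto simp: word_idx_def word_deg_def)
  have fin: "finite (word_idx w)"
    by (rule finite_subset[of _ "Pow {1..word_deg w}"]) (auto simp: word_idx_def)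
  have "word_coprod w = basis_vec (word_term w {}) + (\<Sum>S\<in>word_idx w. basis_vec (word_term w S))"
    unfolding word_coprod_def Pow using fin by (subst sum.insert) (auto simp: word_idx_def)
  also have "(\<Sum>S\<in>word_idx w. basis_vec (word_term w S)) = (\<Sum>S\<in>word_idx w. basis_vec ([word_part w S], word_rgt w S))"
    by (intro sum.cong refl) (simp add: word_term_nonempty word_idx_def)
  finally show "word_coprod w = basis_vec ([], [w]) + (\<Sum>S\<in>word_idx w. basis_vec ([word_part w S], word_rgt w S))"
    by (simp add: word_term_empty)
  have idxl: "{S \<in> Pow {1..length (letters w)}. 1 \<in> S} = word_idxl w"
    by (auto simp: word_idxl_def word_deg_def)
  show "word_coprod_left w = (\<Sum>S\<in>word_idxl w. basis_vec ([word_part w S], word_rgt w S))"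
    unfolding word_coprod_left_def idxl
    by (intro sum.cong refl) (subst word_term_nonempty, auto simp: word_idxl_def)
  show "sum_list (map word_deg (word_rgt w S)) < word_deg w" if "S \<in> word_idxl w"
    using that by (intro word_deg_rgt) (auto simp: word_idx_def word_idxl_def)
qed

section \<open>Characters and infinitesimal characters\<close>

text \<open>One length at a time, so that multilinearity can be proved by induction on the
  length.\<close>

definition nc_multilinear :: "('k::field \<Rightarrow> 'a::ab_group_add \<Rightarrow> 'a) \<Rightarrow> nat \<Rightarrow> ('a nc_word \<Rightarrow> 'k) \<Rightarrow> bool" where
  "nc_multilinear scale n F \<longleftrightarrow> (\<forall>L\<in>NC n. multilinear scale n (\<lambda>a. F (NC_Word (L, a))))"

lemma multiplicative_prod_list:
  assumes "\<Phi> tensor_one = 1" "\<And>u v. \<Phi> (basis_vec (u @ v)) = \<Phi> (basis_vec u) * \<Phi> (basis_vec v)"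
  shows "\<Phi> (basis_vec ws) = prod_list (map (\<lambda>w. \<Phi> (basis_vec [w])) ws)"
proof (induction ws)
  case (Cons w ws)
  then show ?case using assms(2)[of "[w]" ws] by simp
qed (simp add: assms(1))

lemma ball_nc_decorations:
  "(\<forall>(n, mk)\<in>nc_decorations. R n mk) \<longleftrightarrow> (\<forall>n\<ge>1. \<forall>L\<in>NC n. R n (\<lambda>a. NC_Word (L, a)))"
  by (auto simp: nc_decorations_def)

lemma linear_forms_nc_iff:
  "f \<in> linear_forms scale nc_decorations \<longleftrightarrow> is_form f \<and>
     (\<forall>n\<ge>1. \<forall>L\<in>NC n. \<forall>u v. multilinear scale n (\<lambda>a. f (basis_vec (u @ NC_Word (L, a) # v))))"
  unfolding linear_forms_iff ball_nc_decorations ..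

text \<open>For a multiplicative form the words around a given one contribute constant factors, so
  multilinearity has to be checked on single words only.\<close>

lemma G_NC_iff:
  "\<Phi> \<in> G_NC scale \<longleftrightarrow> is_form \<Phi> \<and> \<Phi> tensor_one = 1 \<and>
     (\<forall>u v. \<Phi> (basis_vec (u @ v)) = \<Phi> (basis_vec u) * \<Phi> (basis_vec v)) \<and>
     (\<forall>n\<ge>1. nc_multilinear scale n (\<lambda>w. \<Phi> (basis_vec [w])))" (is "?L \<longleftrightarrow> ?R")
proof
  assume L: ?L
  then have lin: "\<Phi> \<in> linear_forms scale nc_decorations"
    by (simp add: G_NC_def characters_iff)
  then have "multilinear scale n (\<lambda>a. \<Phi> (basis_vec ([] @ NC_Word (L, a) # [])))" if "n \<ge> 1" "L \<in> NC n" for n L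
    using that unfolding linear_forms_nc_iff by blast
  with L lin show ?R
    by (simp add: G_NC_def characters_iff nc_multilinear_def linear_forms_def)
next
  assume R: ?R
  have "multilinear scale n (\<lambda>a. \<Phi> (basis_vec (u @ NC_Word (L, a) # v)))" if "n \<ge> 1" "L \<in> NC n" for n L u v
  proof -
    have "multilinear scale n (\<lambda>a. \<Phi> (basis_vec [NC_Word (L, a)]))"
      using R that by (simp add: nc_multilinear_def)
    then have "multilinear scale n (\<lambda>a. \<Phi> (basis_vec u) * \<Phi> (basis_vec [NC_Word (L, a)]) * \<Phi> (basis_vec v))"
      by (rule multilinear_mult_const)
    moreover have "\<Phi> (basis_vec (u @ NC_Word (L, a) # v)) =
        \<Phi> (basis_vec u) * \<Phi> (basis_vec [NC_Word (L, a)]) * \<Phi> (basis_vec v)" for a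
    proof -
      have "\<Phi> (basis_vec (u @ [NC_Word (L, a)] @ v)) =
          \<Phi> (basis_vec u) * (\<Phi> (basis_vec [NC_Word (L, a)]) * \<Phi> (basis_vec v))"
        using R by (simp only:)
      then show ?thesis by (simp add: mult.assoc)
    qed
    ultimately show ?thesis by simp
  qed
  then have "\<Phi> \<in> linear_forms scale nc_decorations"
    using R unfolding linear_forms_nc_iff by blast
  with R show ?L by (simp add: G_NC_def characters_iff)
qed

lemma g_NC_iff:
  "\<kappa> \<in> g_NC scale \<longleftrightarrow> infinitesimal \<kappa> \<and> (\<forall>n\<ge>1. nc_multilinear scale n (\<lambda>w. \<kappa> (basis_vec [w])))"
  (is "?L \<longleftrightarrow> ?R")
proof
  assume L: ?L
  then have lin: "\<kappa> \<in> linear_forms scale nc_decorations"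
    by (simp add: g_NC_def inf_characters_iff)
  then have "multilinear scale n (\<lambda>a. \<kappa> (basis_vec ([] @ NC_Word (L, a) # [])))" if "n \<ge> 1" "L \<in> NC n" for n L
    using that unfolding linear_forms_nc_iff by blast
  with L show ?R
    by (simp add: g_NC_def inf_characters_iff nc_multilinear_def)
next
  assume R: ?R
  have "multilinear scale n (\<lambda>a. \<kappa> (basis_vec (u @ NC_Word (L, a) # v)))" if "n \<ge> 1" "L \<in> NC n" for n L u v
  proof (cases "u = [] \<and> v = []")
    case True
    then show ?thesis
      using R that by (simp add: nc_multilinear_def)
  next
    case False
    then have "length (u @ NC_Word (L, a) # v) \<noteq> 1" for a by auto
    then have "\<kappa> (basis_vec (u @ NC_Word (L, a) # v)) = 0" for a
      using R unfolding infinitesimal_def by blast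
    then show ?thesis by (simp add: multilinear_def)
  qed
  then have "\<kappa> \<in> linear_forms scale nc_decorations"
    using R unfolding linear_forms_nc_iff infinitesimal_def by blast
  with R show ?L by (simp add: g_NC_def inf_characters_iff)
qed

text \<open>The set \<open>\<Union>Q\<close> and the components of its complement partition [n], so
  each letter enters exactly one factor. The components are proper subsets, which is why
  \<open>G\<close> is constrained only in lengths below \<open>n\<close>, as an induction hypothesis
  provides.\<close>

lemma nc_multilinear_term:
  assumes n: "n \<ge> 1" and L: "L \<in> NC n" and Q: "admissible L Q" "Q \<noteq> {}"
    and F: "nc_multilinear scale (card (\<Union>Q)) F"
    and G: "\<And>m. 1 \<le> m \<Longrightarrow> m < n \<Longrightarrow> nc_multilinear scale m G"
  shows "multilinear scale n (\<lambda>a. F (nc_lft (NC_Word (L, a)) Q) * prod_list (map G (nc_rgt (NC_Word (L, a)) Q)))"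
proof -
  let ?X = "{1..n} - \<Union>Q"
  let ?K = "components ?X"
  \<comment> \<open>The family of factors indexed by the parts of [n]. The case distinction is sound
    because \<open>\<Union>Q\<close> is never a component of its own complement.\<close>
  define H where "H S = (if S = \<Union>Q then (\<lambda>b. F (NC_Word (standardize Q, b)))
    else (\<lambda>b. G (NC_Word (standardize {B \<in> L - Q. B \<subseteq> S}, b))))" for S
  note QN = admissible_NC_on[OF L Q(1)]
  have finQ: "finite (\<Union>Q)" using QN(2) by (rule finite_subset) simp
  have neQ: "\<Union>Q \<noteq> {}" using NC_on_D(1)[OF QN(1)] Q(2) by (auto simp: partition_on_def)
  have part: "partition_on ?X ?K" by (rule partition_on_components) simp
  have notin: "\<Union>Q \<notin> ?K"
    using neQ components_D(2)[of "\<Union>Q" ?X] by blast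
  have "partition_on {1..n} (insert (\<Union>Q) ?K)"
  proof (rule partition_onI)
    have "\<Union>?K = ?X" using part by (simp add: partition_on_def)
    then show "\<Union>(insert (\<Union>Q) ?K) = {1..n}" using QN(2) by auto
    show "{} \<notin> insert (\<Union>Q) ?K" using neQ part by (auto simp: partition_on_def)
    have "disjnt (\<Union>Q) J" if "J \<in> ?K" for J
      using components_D(2)[OF that] by (auto simp: disjnt_def)
    moreover have "disjnt J K" if "J \<in> ?K" "K \<in> ?K" "J \<noteq> K" for J K
      using components_disjnt[OF that(1,2)] that(3) by (auto simp: disjnt_def)
    ultimately show "disjnt p q" if "p \<in> insert (\<Union>Q) ?K" "q \<in> insert (\<Union>Q) ?K" "p \<noteq> q" for p q
      using that by (metis disjnt_sym insertE)
  qed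
  moreover have "multilinear scale (card S) (H S)" if "S \<in> insert (\<Union>Q) ?K" for S
  proof (cases "S = \<Union>Q")
    case True
    then show ?thesis
      using F standardize_in_NC[OF finQ QN(1)] by (simp add: H_def nc_multilinear_def)
  next
    case False
    then have S: "S \<in> ?K" using that by simp
    have finS: "finite S" using components_D(2)[OF S] by (rule finite_subset) simp
    have "S \<subset> {1..n}" using components_D(2)[OF S] neQ QN(2) by auto
    then have "card S < n" using psubset_card_mono[of "{1..n}" S] by simp
    moreover have "1 \<le> card S" using finS components_D(3)[OF S] by (simp add: Suc_le_eq card_gt_0_iff)
    ultimately have "nc_multilinear scale (card S) G" by (intro G)
    then show ?thesis
      using standardize_in_NC[OF finS restrict_in_NC_on[OF L Q(1) S]] False
      by (simp add: H_def nc_multilinear_def)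
  qed
  ultimately have "multilinear scale n (\<lambda>a. \<Prod>S\<in>insert (\<Union>Q) ?K. H S (subword a S))"
    by (rule multilinear_prod_subwords)
  moreover have "(\<Prod>S\<in>insert (\<Union>Q) ?K. H S (subword a S)) =
      F (nc_lft (NC_Word (L, a)) Q) * prod_list (map G (nc_rgt (NC_Word (L, a)) Q))" if "length a = n" for a
  proof -
    have a: "a \<noteq> []" "L \<in> NC (length a)" using that n L by auto
    have "prod_list (map G (nc_rgt (NC_Word (L, a)) Q)) = (\<Prod>J\<in>?K. G (nc_piece (NC_Word (L, a)) Q J))"
      using prod_list_component_list[of ?X "\<lambda>J. G (nc_piece (NC_Word (L, a)) Q J)"]
      by (simp add: nc_rgt_def o_def nc_deg_NC_Word[OF a] that)
    also have "\<dots> = (\<Prod>J\<in>?K. H J (subword a J))"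
    proof (rule prod.cong[OF refl])
      fix J assume "J \<in> ?K"
      then have "J \<noteq> \<Union>Q" using notin by auto
      then show "G (nc_piece (NC_Word (L, a)) Q J) = H J (subword a J)"
        by (simp add: H_def nc_piece_def a)
    qed
    finally show ?thesis
      using notin finite_components[of ?X] by (simp add: H_def nc_lft_def a)
  qed
  ultimately show ?thesis by (subst multilinear_cong[symmetric])
qed

text \<open>The index set of the left coproduct as a function of the partition alone. It stays fixed
  while the letters vary, as needed for sums of multilinear functions.\<close>

definition root_admissible :: "nat set set \<Rightarrow> nat set set set" where
  "root_admissible L = {Q. admissible L Q \<and> (\<exists>B\<in>Q. 1 \<in> B)}"

lemma nc_idxl_NC_Word: "a \<noteq> [] \<Longrightarrow> L \<in> NC (length a) \<Longrightarrow> nc_idxl (NC_Word (L, a)) = root_admissible L"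
  by (simp add: nc_idxl_def root_admissible_def)

text \<open>Multiplicativity is known, so multilinearity on single words remains. It follows by
  induction on the length, since the recursion involves \<kappa> and values on shorter
  words.\<close>

lemma prec_exp_in_G_NC:
  assumes "\<kappa> \<in> g_NC scale"
  shows "prec_exp nc_Delta_left \<kappa> \<in> G_NC scale"
proof -
  let ?\<Phi> = "prec_exp nc_Delta_left \<kappa>"
  have inf: "infinitesimal \<kappa>" and ml: "\<And>n. n \<ge> 1 \<Longrightarrow> nc_multilinear scale n (\<lambda>w. \<kappa> (basis_vec [w]))"
    using assms by (auto simp: g_NC_iff)
  note prod = multiplicative_prod_list[of ?\<Phi>, OF nc.prec_exp_Nil[OF inf] nc.prec_exp_append[OF inf]]
  have "nc_multilinear scale n (\<lambda>w. ?\<Phi> (basis_vec [w]))" if "n \<ge> 1" for n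
    using that
  proof (induction n rule: less_induct)
    case (less n)
    show ?case
      unfolding nc_multilinear_def
    proof
      fix L assume L: "L \<in> NC n"
      have "multilinear scale n (\<lambda>a. \<Sum>Q\<in>root_admissible L. \<kappa> (basis_vec [nc_lft (NC_Word (L, a)) Q]) *
        prod_list (map (\<lambda>w. ?\<Phi> (basis_vec [w])) (nc_rgt (NC_Word (L, a)) Q)))"
      proof (rule multilinear_sum)
        fix Q assume "Q \<in> root_admissible L"
        then have Q: "admissible L Q" "Q \<noteq> {}" "1 \<in> \<Union>Q" by (auto simp: root_admissible_def)
        have "finite (\<Union>Q)" using admissible_NC_on(2)[OF L Q(1)] by (rule finite_subset) simp
        then have "1 \<le> card (\<Union>Q)" using Q(3) by (auto simp: Suc_le_eq card_gt_0_iff)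
        then show "multilinear scale n (\<lambda>a. \<kappa> (basis_vec [nc_lft (NC_Word (L, a)) Q]) *
            prod_list (map (\<lambda>w. ?\<Phi> (basis_vec [w])) (nc_rgt (NC_Word (L, a)) Q)))"
          using less by (intro nc_multilinear_term[OF less.prems L Q(1,2), of _ "\<lambda>w. \<kappa> (basis_vec [w])"] ml)
      qed
      moreover have "?\<Phi> (basis_vec [NC_Word (L, a)]) =
          (\<Sum>Q\<in>root_admissible L. \<kappa> (basis_vec [nc_lft (NC_Word (L, a)) Q]) *
        prod_list (map (\<lambda>w. ?\<Phi> (basis_vec [w])) (nc_rgt (NC_Word (L, a)) Q)))" if "length a = n" for a
      proof -
        have a: "a \<noteq> []" "L \<in> NC (length a)" using that less.prems L by auto
        show ?thesis
          by (subst nc.prec_exp_Cons[OF inf]) (simp only: nc_idxl_NC_Word[OF a] append_Nil2 prod[of "nc_rgt _ _"])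
      qed
      ultimately show "multilinear scale n (\<lambda>a. ?\<Phi> (basis_vec [NC_Word (L, a)]))"
        by (subst multilinear_cong)
    qed
  qed
  then show ?thesis
    unfolding G_NC_iff
    using nc.is_form_prec_exp[OF inf] nc.prec_exp_Nil[OF inf] nc.prec_exp_append[OF inf] by blast
qed

section \<open>The logarithm of a character\<close>

text \<open>Unless all blocks are taken, the points of some omitted block are missing from
  \<open>\<Union>Q\<close>.\<close>

lemma nc_deg_lft_less:
  assumes "Q \<in> nc_idxl w" "Q \<noteq> nc_partition w"
  shows "nc_deg (nc_lft w Q) < nc_deg w"
proof -
  have Q: "Q \<in> nc_idx w" using assms(1) nc_idxl_subset by blast
  have "Q \<subseteq> nc_partition w" using assms(1) by (simp add: nc_idxl_def admissible_def)
  then obtain C where C: "C \<in> nc_partition w" "C \<notin> Q" using assms(2) by blast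
  have part: "partition_on {1..nc_deg w} (nc_partition w)"
    using nc_partition_NC[of w] by (simp add: NC_def nc_deg_def)
  have "C \<noteq> {}" "C \<subseteq> {1..nc_deg w}"
    using C(1) part by (auto simp: partition_on_def)
  moreover have "C \<inter> B = {}" if "B \<in> Q" for B
    using disjointD[OF partition_onD2[OF part] C(1), of B] that C(2) \<open>Q \<subseteq> nc_partition w\<close> by blast
  then have "C \<inter> \<Union>Q = {}" by blast
  ultimately have "\<Union>Q \<subset> {1..nc_deg w}" using Union_nc_idx(2)[OF Q] by blast
  then show ?thesis using psubset_card_mono[of "{1..nc_deg w}" "\<Union>Q"] by (simp add: nc_deg_lft[OF Q])
qed

text \<open>The fixed point recursion solved for \<kappa>: the term of the full partition is
  \<kappa>(\<open>w\<close>) times the value 1 at the unit, and every other term evaluates \<kappa>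
  on a shorter word.\<close>

function nc_log :: "(('a nc_word, 'k::field) tensor \<Rightarrow> 'k) \<Rightarrow> 'a nc_word \<Rightarrow> 'k" where
  "nc_log \<Phi> w = \<Phi> (basis_vec [w]) -
     (\<Sum>Q\<in>nc_idxl w - {nc_partition w}. nc_log \<Phi> (nc_lft w Q) * \<Phi> (basis_vec (nc_rgt w Q)))"
  by pat_completeness auto
termination
  by (relation "measure (\<lambda>(\<Phi>, w). nc_deg w)") (auto intro: nc_deg_lft_less)

declare nc_log.simps [simp del]

lemma nc_partition_in_nc_idxl: "nc_partition w \<in> nc_idxl w"
proof -
  have "\<Union>(nc_partition w) = {1..length (nc_letters w)}"
    using nc_partition_NC[of w] by (simp add: NC_def partition_on_def)
  moreover have "1 \<in> {1..length (nc_letters w)}"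
    using nc_letters_nonempty[of w] by (cases "nc_letters w") auto
  ultimately show ?thesis by (auto simp: nc_idxl_def)
qed

lemma finite_nc_idxl: "finite (nc_idxl w)"
  by (rule finite_subset[OF _ finite_admissible[OF finite_NC_member[OF nc_partition_NC]]])
    (auto simp: nc_idxl_def)

lemma
  shows nc_lft_partition: "nc_lft w (nc_partition w) = w"
    and nc_rgt_partition: "nc_rgt w (nc_partition w) = []"
proof -
  have "\<Union>(nc_partition w) = {1..nc_deg w}"
    using nc_partition_NC[of w] by (simp add: NC_def partition_on_def nc_deg_def)
  then show "nc_lft w (nc_partition w) = w" "nc_rgt w (nc_partition w) = []"
    using subword_all[of "nc_letters w"]
    by (simp_all add: nc_lft_def nc_rgt_def standardize_NC[OF nc_partition_NC] nc_deg_def NC_Word_collapse)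
qed

lemma sum_nc_idxl_remove:
  fixes \<Phi> :: "('a nc_word, 'k::field) tensor \<Rightarrow> 'k"
  assumes "\<Phi> tensor_one = 1"
  shows "(\<Sum>Q\<in>nc_idxl w. k (nc_lft w Q) * \<Phi> (basis_vec (nc_rgt w Q))) = k w +
    (\<Sum>Q\<in>nc_idxl w - {nc_partition w}. k (nc_lft w Q) * \<Phi> (basis_vec (nc_rgt w Q)))"
  using sum.remove[OF finite_nc_idxl nc_partition_in_nc_idxl,
      of "\<lambda>Q. k (nc_lft w Q) * \<Phi> (basis_vec (nc_rgt w Q))" w] assms
  by (simp add: nc_lft_partition nc_rgt_partition)

lemma nc_log_unique:
  assumes "\<Phi> tensor_one = 1"
    "\<And>w. \<Phi> (basis_vec [w]) = (\<Sum>Q\<in>nc_idxl w. k (nc_lft w Q) * \<Phi> (basis_vec (nc_rgt w Q)))"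
  shows "k w = nc_log \<Phi> w"
proof (induction w rule: measure_induct_rule[of nc_deg])
  case (less w)
  have "(\<Sum>Q\<in>nc_idxl w - {nc_partition w}. k (nc_lft w Q) * \<Phi> (basis_vec (nc_rgt w Q))) =
    (\<Sum>Q\<in>nc_idxl w - {nc_partition w}. nc_log \<Phi> (nc_lft w Q) * \<Phi> (basis_vec (nc_rgt w Q)))"
    using less nc_deg_lft_less by (intro sum.cong) auto
  then show ?case
    using assms(2)[of w] by (subst nc_log.simps) (simp add: sum_nc_idxl_remove[of \<Phi>, OF assms(1)])
qed

lemma nc_log_multilinear:
  assumes "\<Phi> \<in> G_NC scale" "n \<ge> 1"
  shows "nc_multilinear scale n (nc_log \<Phi>)"
  using assms(2)
proof (induction n rule: less_induct)
  case (less n)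
  have one: "\<Phi> tensor_one = 1" and mult: "\<And>u v. \<Phi> (basis_vec (u @ v)) = \<Phi> (basis_vec u) * \<Phi> (basis_vec v)"
    and ml: "\<And>n. n \<ge> 1 \<Longrightarrow> nc_multilinear scale n (\<lambda>w. \<Phi> (basis_vec [w]))"
    using assms(1) by (auto simp: G_NC_iff)
  note prod = multiplicative_prod_list[of \<Phi>, OF one mult]
  show ?case
    unfolding nc_multilinear_def
  proof
    fix L assume L: "L \<in> NC n"
    have "multilinear scale n (\<lambda>a. \<Phi> (basis_vec [NC_Word (L, a)]) -
      (\<Sum>Q\<in>root_admissible L - {L}. nc_log \<Phi> (nc_lft (NC_Word (L, a)) Q) *
        prod_list (map (\<lambda>w. \<Phi> (basis_vec [w])) (nc_rgt (NC_Word (L, a)) Q))))"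
    proof (intro multilinear_diff multilinear_sum)
      show "multilinear scale n (\<lambda>a. \<Phi> (basis_vec [NC_Word (L, a)]))"
        using ml[OF less.prems] L by (simp add: nc_multilinear_def)
      fix Q assume Q': "Q \<in> root_admissible L - {L}"
      then have Q: "admissible L Q" "Q \<noteq> {}" "1 \<in> \<Union>Q" by (auto simp: root_admissible_def)
      have "finite (\<Union>Q)" using admissible_NC_on(2)[OF L Q(1)] by (rule finite_subset) simp
      then have card: "1 \<le> card (\<Union>Q)" using Q(3) by (auto simp: Suc_le_eq card_gt_0_iff)
      \<comment> \<open>The inequality for \<open>card (\<Union>Q)\<close> concerns \<open>L\<close>
        and \<open>Q\<close> only, whereas the degree bound is stated for decorated words. The word
        of zeros is a convenient decoration of \<open>L\<close>.\<close>
      let ?w = "NC_Word (L, replicate n 0) :: 'a nc_word"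
      have a: "replicate n (0::'a) \<noteq> []" "L \<in> NC (length (replicate n (0::'a)))" using L less.prems by auto
      have "Q \<in> nc_idxl ?w" "Q \<noteq> nc_partition ?w"
        using Q' by (simp_all add: nc_idxl_NC_Word[OF a] nc_partition_NC_Word[OF a])
      then have "card (\<Union>Q) < n"
        using nc_deg_lft_less[of Q ?w] nc_deg_lft[of Q ?w] nc_idxl_subset[of ?w] nc_deg_NC_Word[OF a] by auto
      then show "multilinear scale n (\<lambda>a. nc_log \<Phi> (nc_lft (NC_Word (L, a)) Q) *
          prod_list (map (\<lambda>w. \<Phi> (basis_vec [w])) (nc_rgt (NC_Word (L, a)) Q)))"
        using less card ml by (intro nc_multilinear_term[OF less.prems L Q(1,2)]) auto
    qed
    moreover have "nc_log \<Phi> (NC_Word (L, a)) = \<Phi> (basis_vec [NC_Word (L, a)]) -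
      (\<Sum>Q\<in>root_admissible L - {L}. nc_log \<Phi> (nc_lft (NC_Word (L, a)) Q) *
        prod_list (map (\<lambda>w. \<Phi> (basis_vec [w])) (nc_rgt (NC_Word (L, a)) Q)))" if "length a = n" for a
    proof -
      have a: "a \<noteq> []" "L \<in> NC (length a)" using that less.prems L by auto
      show ?thesis
        by (subst nc_log.simps, subst prod[of "nc_rgt _ _"])
          (simp add: nc_idxl_NC_Word[OF a] nc_partition_NC_Word[OF a])
    qed
    ultimately show "multilinear scale n (\<lambda>a. nc_log \<Phi> (NC_Word (L, a)))"
      by (subst multilinear_cong)
  qed
qed

definition nc_log_form :: "(('a nc_word, 'k::field) tensor \<Rightarrow> 'k) \<Rightarrow> ('a nc_word, 'k) tensor \<Rightarrow> 'k" where
  "nc_log_form \<Phi> = eval_form (\<lambda>ws. if length ws = 1 then nc_log \<Phi> (hd ws) else 0)"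

lemma nc_log_form_in_g_NC:
  assumes "\<Phi> \<in> G_NC scale"
  shows "nc_log_form \<Phi> \<in> g_NC scale"
  using nc_log_multilinear[OF assms]
  by (simp add: g_NC_iff infinitesimal_def nc_log_form_def)

text \<open>For a character the equation at \<open>w # ws\<close> is the equation at
  \<open>[w]\<close> multiplied by the value at \<open>ws\<close>. Only the equations on single
  words count, and \<open>nc_log\<close> is their unique solution.\<close>

lemma fixed_point_nc_iff:
  assumes "\<Phi> \<in> G_NC scale" "\<kappa> \<in> g_NC scale"
  shows "\<Phi> = (\<lambda>v. unit_form v + prec nc_Delta_left \<kappa> \<Phi> v) \<longleftrightarrow> \<kappa> = nc_log_form \<Phi>"
proof -
  have one: "\<Phi> tensor_one = 1" and mult: "\<And>u v. \<Phi> (basis_vec (u @ v)) = \<Phi> (basis_vec u) * \<Phi> (basis_vec v)"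
    and form: "is_form \<Phi>"
    using assms(1) by (auto simp: G_NC_iff)
  have inf: "infinitesimal \<kappa>" using assms(2) by (simp add: g_NC_iff)
  let ?rec = "\<lambda>w. \<Phi> (basis_vec [w]) =
    (\<Sum>Q\<in>nc_idxl w. \<kappa> (basis_vec [nc_lft w Q]) * \<Phi> (basis_vec (nc_rgt w Q)))"
  have "\<Phi> (basis_vec (w # ws)) =
      (\<Sum>Q\<in>nc_idxl w. \<kappa> (basis_vec [nc_lft w Q]) * \<Phi> (basis_vec (nc_rgt w Q @ ws)))" if "?rec w" for w ws
    using that mult[of "[w]" ws] by (simp add: mult sum_distrib_right mult.assoc)
  moreover have "?rec w" if "\<Phi> (basis_vec (w # [])) =
      (\<Sum>Q\<in>nc_idxl w. \<kappa> (basis_vec [nc_lft w Q]) * \<Phi> (basis_vec (nc_rgt w Q @ [])))" for w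
    using that by simp
  ultimately have "\<Phi> = (\<lambda>v. unit_form v + prec nc_Delta_left \<kappa> \<Phi> v) \<longleftrightarrow> (\<forall>w. ?rec w)"
    unfolding nc.fixed_point_iff[OF inf form] using one by blast
  also have "\<dots> \<longleftrightarrow> (\<forall>w. \<kappa> (basis_vec [w]) = nc_log \<Phi> w)"
  proof
    assume "\<forall>w. ?rec w"
    then show "\<forall>w. \<kappa> (basis_vec [w]) = nc_log \<Phi> w"
      using nc_log_unique[of \<Phi> "\<lambda>w. \<kappa> (basis_vec [w])", OF one] by blast
  next
    assume *: "\<forall>w. \<kappa> (basis_vec [w]) = nc_log \<Phi> w"
    have "?rec w" for w
      unfolding *[rule_format] sum_nc_idxl_remove[of \<Phi> "nc_log \<Phi>", OF one]
      using nc_log.simps[of \<Phi> w] by (simp add: algebra_simps)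
    then show "\<forall>w. ?rec w" by blast
  qed
  also have "\<dots> \<longleftrightarrow> \<kappa> = nc_log_form \<Phi>"
  proof
    assume *: "\<forall>w. \<kappa> (basis_vec [w]) = nc_log \<Phi> w"
    show "\<kappa> = nc_log_form \<Phi>"
    proof (rule form_eqI)
      show "is_form \<kappa>" using inf by (simp add: infinitesimal_def)
      show "is_form (nc_log_form \<Phi>)" by (simp add: nc_log_form_def)
      fix ws
      show "\<kappa> (basis_vec ws) = nc_log_form \<Phi> (basis_vec ws)"
      proof (cases "length ws = 1")
        case True
        then obtain w where "ws = [w]" by (auto simp: length_Suc_conv)
        then show ?thesis using * by (simp add: nc_log_form_def)
      next
        case False
        then show ?thesis using inf by (simp add: infinitesimal_def nc_log_form_def)
      qed
    qed
  qed (simp add: nc_log_form_def)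
  finally show ?thesis .
qed

section \<open>The splitting map\<close>

text \<open>Sums over pairs (\<open>L\<close>, \<open>Q\<close>) become sums over \<open>S\<close>,
  a partition of \<open>S\<close>, and a partition of each component of the complement; these
  choices are independent, so the sum factorizes.\<close>

lemma sum_root_admissible:
  fixes K :: "nat set set \<Rightarrow> 'k::comm_semiring_1" and G :: "nat set \<Rightarrow> nat set set \<Rightarrow> 'k"
  shows "(\<Sum>L\<in>NC n. \<Sum>Q\<in>root_admissible L. K Q * (\<Prod>J\<in>components ({1..n} - \<Union>Q). G J {B \<in> L - Q. B \<subseteq> J})) =
    (\<Sum>S | S \<subseteq> {1..n} \<and> 1 \<in> S. (\<Sum>Q\<in>NC_on S. K Q) *
      (\<Prod>J\<in>components ({1..n} - S). \<Sum>P\<in>NC_on J. G J P))"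
proof -
  let ?C = "\<lambda>S. components ({1..n} - S)"
  let ?A = "{S. S \<subseteq> {1..n} \<and> 1 \<in> S}"
  let ?T = "Sigma ?A (\<lambda>S. NC_on S \<times> PiE (?C S) NC_on)"
  have finS: "finite S" if "S \<subseteq> {1..n}" for S using that finite_subset by blast
  have finA: "finite ?A" by (rule finite_subset[of _ "Pow {1..n}"]) auto
  have finC: "finite (?C S)" for S by (rule finite_components) simp
  have finJ: "finite (NC_on J)" if "J \<in> ?C S" for J S
    using components_D(2)[OF that] by (intro finite_NC_on) (auto intro: finite_subset)
  have finT: "finite (NC_on S \<times> PiE (?C S) NC_on)" if "S \<in> ?A" for S
    using that finC finJ[of _ S] finite_NC_on[OF finS] by (intro finite_cartesian_product finite_PiE) auto
  have fin_root: "finite (root_admissible L)" if "L \<in> NC n" for L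
    by (rule finite_subset[OF _ finite_admissible[OF finite_NC_member[OF that]]]) (auto simp: root_admissible_def)
  have finNC: "finite (NC n)" by (simp add: NC_eq_NC_on finite_NC_on)
  have "(\<Sum>L\<in>NC n. \<Sum>Q\<in>root_admissible L. K Q * (\<Prod>J\<in>?C (\<Union>Q). G J {B \<in> L - Q. B \<subseteq> J})) =
    (\<Sum>(L, Q)\<in>Sigma (NC n) root_admissible. K Q * (\<Prod>J\<in>?C (\<Union>Q). G J {B \<in> L - Q. B \<subseteq> J}))"
    using finNC fin_root by (subst sum.Sigma) auto
  \<comment> \<open>One direction restricts \<open>L\<close> to the components, the other glues. The
    restriction is taken as an extensional function, because \<open>PiE\<close> fixes the values off
    the components and only then are the two maps inverse.\<close>
  also have "\<dots> = (\<Sum>(S, Q, P)\<in>?T. K Q * (\<Prod>J\<in>?C S. G J (P J)))"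
  proof (rule sum.reindex_bij_witness
      [where i = "\<lambda>(S, Q, P). (Q \<union> (\<Union>J\<in>?C S. P J), Q)"
        and j = "\<lambda>(L, Q). (\<Union>Q, Q, \<lambda>J\<in>?C (\<Union>Q). {B \<in> L - Q. B \<subseteq> J})"], goal_cases)
    case (1 x)
    then obtain L Q where x: "x = (L, Q)" and L: "L \<in> NC n" and Q: "admissible L Q"
      by (auto simp: root_admissible_def)
    have "L \<subseteq> Q \<union> (\<Union>J\<in>?C (\<Union>Q). {B \<in> L - Q. B \<subseteq> J})"
      using block_in_component[OF L Q] by blast
    moreover have "Q \<subseteq> L" using Q by (simp add: admissible_def)
    ultimately have "Q \<union> (\<Union>J\<in>?C (\<Union>Q). {B \<in> L - Q. B \<subseteq> J}) = L" by blast
    then show ?case by (simp add: x)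
  next
    case (2 x)
    then obtain L Q where x: "x = (L, Q)" and L: "L \<in> NC n" and Q: "admissible L Q" and one: "1 \<in> \<Union>Q"
      by (auto simp: root_admissible_def)
    show ?case
      using admissible_NC_on[OF L Q] restrict_in_NC_on[OF L Q] one by (auto simp: x)
  next
    case (3 x)
    then obtain S Q P where x: "x = (S, Q, P)" and S: "S \<subseteq> {1..n}" and Q: "Q \<in> NC_on S"
      and P: "P \<in> PiE (?C S) NC_on" by auto
    have "P J \<in> NC_on J" if "J \<in> ?C S" for J using P that by (auto simp: PiE_def)
    note glue = admissible_glue[OF S Q this]
    have "(\<lambda>J\<in>?C S. {B \<in> Q \<union> (\<Union>J\<in>?C S. P J) - Q. B \<subseteq> J}) = P"
    proof
      fix J
      show "(\<lambda>J\<in>?C S. {B \<in> Q \<union> (\<Union>J\<in>?C S. P J) - Q. B \<subseteq> J}) J = P J"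
      proof (cases "J \<in> ?C S")
        case True
        then show ?thesis using glue(3)[OF _ True] by simp
      next
        case False
        then show ?thesis using PiE_arb[OF P False] by simp
      qed
    qed
    then show ?case using NC_on_D(3)[OF Q] by (simp add: x)
  next
    case (4 x)
    then obtain S Q P where x: "x = (S, Q, P)" and S: "S \<subseteq> {1..n}" "1 \<in> S" and Q: "Q \<in> NC_on S"
      and P: "P \<in> PiE (?C S) NC_on" by auto
    have "P J \<in> NC_on J" if "J \<in> ?C S" for J using P that by (auto simp: PiE_def)
    note glue = admissible_glue[OF S(1) Q this]
    have "\<exists>B\<in>Q. 1 \<in> B" using NC_on_D(3)[OF Q] S(2) by blast
    then show ?case using glue(1,2) by (simp add: x root_admissible_def)
  next
    case (5 x)
    then show ?case by (auto intro!: arg_cong2[where f = "(*)"] prod.cong)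
  qed
  also have "\<dots> = (\<Sum>S\<in>?A. \<Sum>(Q, P)\<in>NC_on S \<times> PiE (?C S) NC_on. K Q * (\<Prod>J\<in>?C S. G J (P J)))"
    using finA finT by (subst sum.Sigma) (auto simp: split_def)
  also have "\<dots> = (\<Sum>S\<in>?A. (\<Sum>Q\<in>NC_on S. K Q) * (\<Prod>J\<in>?C S. \<Sum>P\<in>NC_on J. G J P))"
  proof (rule sum.cong[OF refl])
    fix S
    \<comment> \<open>A product of sums is expanded into a sum over choice functions, one partition
      for each component.\<close>
    show "(\<Sum>(Q, P)\<in>NC_on S \<times> PiE (?C S) NC_on. K Q * (\<Prod>J\<in>?C S. G J (P J))) =
      (\<Sum>Q\<in>NC_on S. K Q) * (\<Prod>J\<in>?C S. \<Sum>P\<in>NC_on J. G J P)"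
      by (subst prod_sum_PiE[OF finC finJ]) (simp_all add: sum.cartesian_product[symmetric] sum_product)
  qed
  finally show ?thesis .
qed

section \<open>Pullback of forms along the splitting map\<close>

lemma is_form_Sp_star: "is_form f \<Longrightarrow> is_form (Sp_star f)"
proof -
  assume "is_form f"
  then have "Sp_star f = eval_form (\<lambda>ws. f (split_bar ws))"
    by (auto simp: Sp_star_def Sp_def form_linear_ext)
  then show ?thesis by simp
qed

lemma Sp_star_basis: "Sp_star f (basis_vec ws) = f (split_bar ws)"
  by (simp add: Sp_star_def Sp_def linear_ext_def)

lemma form_split_word:
  "is_form f \<Longrightarrow> f (split_word w) = (\<Sum>L\<in>NC (word_deg w). f (basis_vec [NC_Word (L, letters w)]))"
  by (simp add: split_word_def form_sum word_deg_def)

lemma bar_tensor_one: "bar v tensor_one = v"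
proof -
  have "Poly_Mapping.lookup (bar v tensor_one) x = Poly_Mapping.lookup v x" for x
    using form_bar[OF is_form_lookup, of v tensor_one x]
      form_eq_eval_form[OF is_form_lookup, of v x] by simp
  then show ?thesis by (rule poly_mapping_eqI)
qed

lemma Sp_star_single:
  "is_form f \<Longrightarrow> Sp_star f (basis_vec [w]) = (\<Sum>L\<in>NC (word_deg w). f (basis_vec [NC_Word (L, letters w)]))"
  by (simp add: Sp_star_basis bar_tensor_one form_split_word)

lemma Sp_star_multiplicative:
  assumes "is_form \<Phi>" "\<Phi> tensor_one = 1" "\<And>u v. \<Phi> (basis_vec (u @ v)) = \<Phi> (basis_vec u) * \<Phi> (basis_vec v)"
  shows "Sp_star \<Phi> (basis_vec ws) = prod_list (map (\<lambda>w. Sp_star \<Phi> (basis_vec [w])) ws)"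
proof (induction ws)
  case (Cons w ws)
  then show ?case
    by (simp add: Sp_star_basis form_bar_multiplicative[OF assms(1,3)] bar_tensor_one)
qed (simp add: Sp_star_basis assms(2))

lemma augmentation_ideal_iff: "v \<in> augmentation_ideal \<longleftrightarrow> unit_form v = 0"
  by (simp add: augmentation_ideal_def unit_form_def)

text \<open>The splitting map sends each word into the augmentation ideal, so a bar word of two or
  more words becomes a product on which \<kappa> vanishes.\<close>

lemma infinitesimal_Sp_star:
  fixes \<kappa> :: "('a nc_word, 'k::field) tensor \<Rightarrow> 'k"
  assumes "infinitesimal \<kappa>"
  shows "infinitesimal (Sp_star \<kappa>)"
proof -
  have form: "is_form \<kappa>" using assms by (simp add: infinitesimal_def)
  have word: "split_word w \<in> (augmentation_ideal :: ('a nc_word, 'k) tensor set)" for w :: "'a word"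
    using form_split_word[OF is_form_unit_form, of w]
    by (simp add: augmentation_ideal_iff unit_form_basis)
  have bar: "split_bar (w # ws) \<in> (augmentation_ideal :: ('a nc_word, 'k) tensor set)" for w :: "'a word" and ws
    using word[of w] by (simp add: augmentation_ideal_iff form_bar_multiplicative unit_form_basis)
  have "Sp_star \<kappa> (basis_vec ws) = 0" if len: "length ws \<noteq> 1" for ws
  proof (cases ws)
    case Nil
    then show ?thesis using assms by (simp add: Sp_star_basis infinitesimal_def)
  next
    case (Cons w vs)
    then obtain w' vs' where "vs = w' # vs'" using len by (cases vs) auto
    then show ?thesis
      using Cons infinitesimal_bar[OF assms word bar, of w w' vs'] by (simp add: Sp_star_basis)
  qed
  then show ?thesis using is_form_Sp_star[OF form] by (simp add: infinitesimal_def)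
qed

text \<open>Standardization reindexes the sum by partitions of \<open>S\<close> itself, the shape in
  which the factors of \<open>sum_root_admissible\<close> appear.\<close>

lemma Sp_star_word_part:
  assumes "is_form f" "finite S" "S \<noteq> {}"
  shows "Sp_star f (basis_vec [word_part w S]) =
    (\<Sum>P\<in>NC_on S. f (basis_vec [NC_Word (standardize P, subword (letters w) S)]))"
  using sum.reindex_bij_betw[OF bij_betw_standardize[OF assms(2)],
      of "\<lambda>P. f (basis_vec [NC_Word (P, subword (letters w) S)])"]
  by (simp add: Sp_star_single[OF assms(1)] word_deg_part[OF assms(2,3)] letters_word_part[OF assms(2,3)])

lemma Sp_star_fixed_point:
  assumes \<Phi>: "\<Phi> \<in> G_NC scale" and \<kappa>: "\<kappa> \<in> g_NC scale"
    and eq: "\<Phi> = (\<lambda>v. unit_form v + prec nc_Delta_left \<kappa> \<Phi> v)"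
  shows "Sp_star \<Phi> = (\<lambda>v. unit_form v + prec word_Delta_left (Sp_star \<kappa>) (Sp_star \<Phi>) v)"
proof -
  have one: "\<Phi> tensor_one = 1" and mult: "\<And>u v. \<Phi> (basis_vec (u @ v)) = \<Phi> (basis_vec u) * \<Phi> (basis_vec v)"
    and form: "is_form \<Phi>"
    using \<Phi> by (auto simp: G_NC_iff)
  have inf: "infinitesimal \<kappa>" using \<kappa> by (simp add: g_NC_iff)
  then have form\<kappa>: "is_form \<kappa>" by (simp add: infinitesimal_def)
  have rec: "\<Phi> (basis_vec [w]) = (\<Sum>Q\<in>nc_idxl w. \<kappa> (basis_vec [nc_lft w Q]) * \<Phi> (basis_vec (nc_rgt w Q)))" for w
    using iffD1[OF nc.fixed_point_iff[OF inf form] eq, THEN conjunct2, rule_format, of w "[]"]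
    by (simp only: append_Nil2)
  note prod = multiplicative_prod_list[of \<Phi>, OF one mult]
  note Sp_prod = Sp_star_multiplicative[OF form one mult]
  have single: "Sp_star \<Phi> (basis_vec [w]) =
    (\<Sum>S\<in>word_idxl w. Sp_star \<kappa> (basis_vec [word_part w S]) * Sp_star \<Phi> (basis_vec (word_rgt w S)))" for w
  proof -
    let ?n = "word_deg w" and ?a = "letters w"
    \<comment> \<open>\<open>K\<close> and \<open>G\<close> absorb the letters, leaving functions of
      partitions to which the factorization applies.\<close>
    define K where "K Q = \<kappa> (basis_vec [NC_Word (standardize Q, subword ?a (\<Union>Q))])" for Q
    define G where "G J P = \<Phi> (basis_vec [NC_Word (standardize P, subword ?a J)])" for J P
    have "\<Phi> (basis_vec [NC_Word (L, ?a)]) =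
      (\<Sum>Q\<in>root_admissible L. K Q * (\<Prod>J\<in>components ({1..?n} - \<Union>Q). G J {B \<in> L - Q. B \<subseteq> J}))"
      if "L \<in> NC ?n" for L
    proof -
      have a: "?a \<noteq> []" "L \<in> NC (length ?a)" using letters_nonempty that by (auto simp: word_deg_def)
      have "\<Phi> (basis_vec (nc_rgt (NC_Word (L, ?a)) Q)) =
        (\<Prod>J\<in>components ({1..?n} - \<Union>Q). G J {B \<in> L - Q. B \<subseteq> J})" for Q
        by (subst prod) (simp add: nc_rgt_def o_def prod_list_component_list nc_piece_def G_def a
            nc_deg_NC_Word[OF a] word_deg_def)
      then show ?thesis
        by (subst rec) (simp add: nc_idxl_NC_Word[OF a] nc_lft_def a K_def)
    qed
    then have "Sp_star \<Phi> (basis_vec [w]) = (\<Sum>L\<in>NC ?n. \<Sum>Q\<in>root_admissible L.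
        K Q * (\<Prod>J\<in>components ({1..?n} - \<Union>Q). G J {B \<in> L - Q. B \<subseteq> J}))"
      by (simp add: Sp_star_single[OF form])
    also have "\<dots> = (\<Sum>S\<in>word_idxl w. (\<Sum>Q\<in>NC_on S. K Q) *
      (\<Prod>J\<in>components ({1..?n} - S). \<Sum>P\<in>NC_on J. G J P))"
      unfolding word_idxl_def by (rule sum_root_admissible)
    also have "\<dots> = (\<Sum>S\<in>word_idxl w. Sp_star \<kappa> (basis_vec [word_part w S]) * Sp_star \<Phi> (basis_vec (word_rgt w S)))"
    proof (rule sum.cong[OF refl])
      fix S assume "S \<in> word_idxl w"
      then have "S \<subseteq> {1..?n}" and ne: "S \<noteq> {}" by (auto simp: word_idxl_def)
      then have fin: "finite S" using finite_subset by blast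
      have "(\<Sum>Q\<in>NC_on S. K Q) = Sp_star \<kappa> (basis_vec [word_part w S])"
        unfolding Sp_star_word_part[OF form\<kappa> fin ne] K_def
        using NC_on_D(3) by (intro sum.cong) auto
      moreover have "(\<Prod>J\<in>components ({1..?n} - S). \<Sum>P\<in>NC_on J. G J P) = Sp_star \<Phi> (basis_vec (word_rgt w S))"
      proof -
        have "(\<Sum>P\<in>NC_on J. G J P) = Sp_star \<Phi> (basis_vec [word_part w J])"
          if J: "J \<in> components ({1..?n} - S)" for J
        proof -
          have "finite J" using components_D(2)[OF J] by (rule finite_subset) simp
          then show ?thesis unfolding G_def using components_D(3)[OF J] by (simp add: Sp_star_word_part[OF form])
        qed
        then show ?thesis
          by (subst Sp_prod) (simp add: word_rgt_def o_def prod_list_component_list)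
      qed
      ultimately show "(\<Sum>Q\<in>NC_on S. K Q) * (\<Prod>J\<in>components ({1..?n} - S). \<Sum>P\<in>NC_on J. G J P) =
        Sp_star \<kappa> (basis_vec [word_part w S]) * Sp_star \<Phi> (basis_vec (word_rgt w S))" by simp
    qed
    finally show ?thesis .
  qed
  have append: "Sp_star \<Phi> (basis_vec (u @ v)) = Sp_star \<Phi> (basis_vec u) * Sp_star \<Phi> (basis_vec v)" for u v
    using Sp_prod[of "u @ v"] Sp_prod[of u] Sp_prod[of v] by simp
  \<comment> \<open>Multiplying the single-word recursion by the value at \<open>ws\<close> extends
    it to all bar words.\<close>
  have "Sp_star \<Phi> (basis_vec (w # ws)) = (\<Sum>S\<in>word_idxl w. Sp_star \<kappa> (basis_vec [word_part w S]) *
    Sp_star \<Phi> (basis_vec (word_rgt w S @ ws)))" for w ws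
    using append[of "[w]" ws] single[of w] by (simp add: append sum_distrib_right mult.assoc)
  moreover have "Sp_star \<Phi> tensor_one = 1" by (simp add: Sp_star_basis one)
  ultimately show ?thesis
    by (intro iffD2[OF wd.fixed_point_iff[OF infinitesimal_Sp_star[OF inf] is_form_Sp_star[OF form]]]) blast
qed

theorem mainTheorem7:
  fixes scale :: "'k::field_char_0 \<Rightarrow> 'a::{ring,monoid_mult} \<Rightarrow> 'a"
  assumes "is_algebra scale"
  shows "(\<forall>\<Phi>\<in>G_NC scale. \<exists>!\<kappa>. \<kappa> \<in> g_NC scale \<and>
            \<Phi> = (\<lambda>v. unit_form v + prec nc_Delta_left \<kappa> \<Phi> v) \<and>
            \<Phi> = prec_exp nc_Delta_left \<kappa>)
       \<and> (\<forall>\<kappa>\<in>g_NC scale. prec_exp nc_Delta_left \<kappa> \<in> G_NC scale)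
       \<and> bij_betw (prec_exp nc_Delta_left) (g_NC scale) (G_NC scale)
       \<and> (\<forall>\<Phi>\<in>G_NC scale. \<forall>\<kappa>\<in>g_NC scale.
            \<Phi> = (\<lambda>v. unit_form v + prec nc_Delta_left \<kappa> \<Phi> v) \<and>
            \<Phi> = prec_exp nc_Delta_left \<kappa> \<longrightarrow>
            Sp_star \<Phi> = (\<lambda>v. unit_form v + prec word_Delta_left (Sp_star \<kappa>) (Sp_star \<Phi>) v) \<and>
            Sp_star \<Phi> = prec_exp word_Delta_left (Sp_star \<kappa>))"
proof -
  \<comment> \<open>For a given character and infinitesimal character, the fixed point equation, the
    exponential formula and the logarithm formula are equivalent. Existence, uniqueness and
    bijectivity are all read off from this.\<close>
  have exp_iff: "\<Phi> = (\<lambda>v. unit_form v + prec nc_Delta_left \<kappa> \<Phi> v) \<longleftrightarrow> \<Phi> = prec_exp nc_Delta_left \<kappa>"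
    and log_iff: "\<Phi> = prec_exp nc_Delta_left \<kappa> \<longleftrightarrow> \<kappa> = nc_log_form \<Phi>"
    if "\<Phi> \<in> G_NC scale" "\<kappa> \<in> g_NC scale" for \<Phi> \<kappa>
  proof -
    have "is_form \<Phi>" "infinitesimal \<kappa>" using that by (simp_all add: G_NC_iff g_NC_iff)
    then show *: "\<Phi> = (\<lambda>v. unit_form v + prec nc_Delta_left \<kappa> \<Phi> v) \<longleftrightarrow> \<Phi> = prec_exp nc_Delta_left \<kappa>"
      by (intro nc.fixed_point_iff_prec_exp)
    show "\<Phi> = prec_exp nc_Delta_left \<kappa> \<longleftrightarrow> \<kappa> = nc_log_form \<Phi>"
      using fixed_point_nc_iff[OF that] * by (rule trans[OF sym, rotated])
  qed
  have "\<exists>!\<kappa>. \<kappa> \<in> g_NC scale \<and> \<Phi> = (\<lambda>v. unit_form v + prec nc_Delta_left \<kappa> \<Phi> v) \<and>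
            \<Phi> = prec_exp nc_Delta_left \<kappa>" if \<Phi>: "\<Phi> \<in> G_NC scale" for \<Phi>
  proof (rule ex1I[of _ "nc_log_form \<Phi>"])
    show "nc_log_form \<Phi> \<in> g_NC scale \<and> \<Phi> = (\<lambda>v. unit_form v + prec nc_Delta_left (nc_log_form \<Phi>) \<Phi> v) \<and>
            \<Phi> = prec_exp nc_Delta_left (nc_log_form \<Phi>)"
      using exp_iff[OF \<Phi>] log_iff[OF \<Phi>] nc_log_form_in_g_NC[OF \<Phi>] by blast
  qed (use log_iff[OF \<Phi>] in blast)
  moreover have "bij_betw (prec_exp nc_Delta_left) (g_NC scale) (G_NC scale)"
  proof (rule bij_betwI[of _ _ _ nc_log_form])
    show "prec_exp nc_Delta_left \<in> g_NC scale \<rightarrow> G_NC scale" using prec_exp_in_G_NC by blast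
    show "nc_log_form \<in> G_NC scale \<rightarrow> g_NC scale" using nc_log_form_in_g_NC by blast
    show "nc_log_form (prec_exp nc_Delta_left \<kappa>) = \<kappa>" if "\<kappa> \<in> g_NC scale" for \<kappa>
      using log_iff[OF prec_exp_in_G_NC[OF that] that] by simp
    show "prec_exp nc_Delta_left (nc_log_form \<Phi>) = \<Phi>" if "\<Phi> \<in> G_NC scale" for \<Phi>
      using log_iff[OF that nc_log_form_in_g_NC[OF that]] by simp
  qed
  moreover have "Sp_star \<Phi> = (\<lambda>v. unit_form v + prec word_Delta_left (Sp_star \<kappa>) (Sp_star \<Phi>) v) \<and>
            Sp_star \<Phi> = prec_exp word_Delta_left (Sp_star \<kappa>)"
    if "\<Phi> \<in> G_NC scale" "\<kappa> \<in> g_NC scale" "\<Phi> = (\<lambda>v. unit_form v + prec nc_Delta_left \<kappa> \<Phi> v)" for \<Phi> \<kappa>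
  proof -
    have "is_form \<Phi>" "infinitesimal \<kappa>" using that(1,2) by (simp_all add: G_NC_iff g_NC_iff)
    note wd.fixed_point_iff_prec_exp[OF infinitesimal_Sp_star[OF this(2)] is_form_Sp_star[OF this(1)]]
    with Sp_star_fixed_point[OF that] show ?thesis by blast
  qed
  ultimately show ?thesis using prec_exp_in_G_NC by blast
qed

end
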